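(* Let $\mathfrak{F}\subseteq\mathfrak{F}_{\mathrm{all}}$ satisfy $\mathfrak{F}\supseteq\mathfrak{F}_{\mathrm{AR}(2)}^{ext}$ and suppose that the polynomial trend assumption holds: $X=(F,\tilde X)$, where $F$ is $n\times k_F$-dimensional ($1\le k_F\le k$) with $j$-th column $(1^{j-1},\ldots,n^{j-1})'$, where $\tilde X$ is an $n\times(k-k_F)$-dimensional matrix such that $X$ has rank $k$ ($\tilde X$ is the empty matrix if $k_F=k$), and the restriction matrix $R$ has a nonzero column $R_{\cdot l}$ for some $l\in\{1,\ldots,k_F\}$. Let $V\in\{A,I_n\}$, $c\in\mathbb{R}$, $i\in\{1,2\}$, and let $U$ be an $n\times m$-dimensional matrix with $m\ge1$, $k+m<n$, such that $(X,U)$ is of full column-rank. Then $\check\beta=\check\beta_V$ and $\check\Omega=\check\Omega_{c,U,i,V}^{\mathrm{Vo}}$ satisfy the estimator conditions with $N=\mathrm{span}(X,U)$. Let $T$ be the nonsphericity-corrected F-type test statistic with $\check\beta=\check\beta_V$, $\check\Omega=\check\Omega_{c,U,i,V}^{\mathrm{Vo}}$, and $N=\mathrm{span}(X,U)$. Then $$\sup_{f\in\mathfrak{F}}P_{\mu_0,\sigma^2\Sigma(f)}(T\ge C)=1$$ holds for every critical value $C$, $-\infty<C<\infty$, for every $\mu_0\in\mathfrak{M}_0$, and for every $\sigma^2\in(0,\infty)$.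
   Context: Model: $n,k,q$ are positive integers with $1\le k<n$; $X\in\mathbb{R}^{n\times k}$ is a fixed matrix of rank $k$; $R\in\mathbb{R}^{q\times k}$ has rank $q\ge 1$; $r\in\mathbb{R}^q$. (One tests $R\beta=r$ in $\mathbf{Y}=X\beta+\mathbf{U}$, $\mathbf{U}\sim N(0,\sigma^2\Sigma(f))$, $0<\sigma^2<\infty$, $f\in\mathfrak{F}$.) $'$ is transpose, $\mathrm{span}(\cdot)$ is column space, $\Pi_{\mathcal{L}}$ is orthogonal projection onto $\mathcal{L}$, $\mathfrak{M}_0=\{X\beta:R\beta=r\}$; for a matrix $Z$ of full column rank, $\hat\beta_Z(y)=(Z'Z)^{-1}Z'y$. $P_{\mu,B}$ is the Gaussian measure on $\mathbb{R}^n$ with mean $\mu$ and covariance $B$; $P(T\ge C)$ means $P(\{y:T(y)\ge C\})$. $\lambda_{\mathbb{R}^n}$ is Lebesgue measure. Spectral densities: $\mathfrak{F}_{\mathrm{all}}$ is the set of all normalized spectral densities of real weakly stationary processes (nonnegative, even, integrable $f$ on $[-\pi,\pi]$ with $\int_{-\pi}^{\pi}f=1$); $\mathfrak{F}_{\mathrm{AR}(2)}$ is the subset of those corresponding to stationary autoregressive processes of order at most two; $\mathfrak{F}_{\mathrm{AR}(2)}^{ext}$ is the set of all $c_1f+(2\pi)^{-1}c_2$ with $f\in\mathfrak{F}_{\mathrm{AR}(2)}$, $c_1,c_2\ge0$, $c_1+c_2=1$; $\Sigma(f)=\left[\int_{-\pi}^{\pi}e^{-\iota(j-l)\omega}f(\omega)d\omega\right]_{j,l=1}^n$,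 $\iota$ the imaginary unit. Estimators: $A$ is the $n\times n$ matrix with $0$ above the main diagonal and $1$ on and below it. For $V\in\{A,I_n\}$, $$\check\beta_V(y)=\hat\beta_{VX}(Vy)=(X'V'VX)^{-1}X'V'Vy,$$ $$\check\Omega_{c,U,i,V}^{\mathrm{Vo}}(y)=n^{j(V)}s_{A,X}^2(y)\exp(cJ_{n,U}^i(y))R(X'V'VX)^{-1}R',$$ with $j(A)=1$, $j(I_n)=-1$. Here $s_{D_1,D_2}^2(y)=n^{-1}y'D_1'\Pi_{\mathrm{span}(D_1D_2)^\perp}D_1y$ for nonsingular $D_1\in\mathbb{R}^{n\times n}$ and $D_2\in\mathbb{R}^{n\times l}$ of rank $l\le n$, $G=(0,I_m)\in\mathbb{R}^{m\times(k+m)}$, and $$J_{n,U}^1(y)=n^{-1}\hat\beta_{(X,U)}'(y)G'\left(s_{I_n,(X,U)}^2(y)G((X,U)'(X,U))^{-1}G'\right)^{-1}G\hat\beta_{(X,U)}(y),$$ $$J_{n,U}^2(y)=n^{-1}\hat\beta_{A(X,U)}'(Ay)G'\left(s_{A,(X,U)}^2(y)G((X,U)'A'A(X,U))^{-1}G'\right)^{-1}G\hat\beta_{A(X,U)}(Ay).$$ $\check\Omega_{c,U,i,V}^{\mathrm{Vo}}$ is well-defined precisely on $\mathbb{R}^n\setminus\mathrm{span}(X,U)$. Estimator conditions on $(\check\beta,\check\Omega,N)$: (i) $\check\beta:\mathbb{R}^n\setminus N\to\mathbb{R}^k$ and $\check\Omega:\mathbb{R}^n\setminus N\to\mathbb{R}^{q\times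 q}$ are well-defined and continuous on $\mathbb{R}^n\setminus N$, where $N$ is a closed $\lambda_{\mathbb{R}^n}$-null set, and $\check\Omega(y)$ is symmetric for every $y\in\mathbb{R}^n\setminus N$; (ii) $y\in\mathbb{R}^n\setminus N$ implies $\delta y+X\eta\in\mathbb{R}^n\setminus N$ for all $\delta\ne0$, $\eta\in\mathbb{R}^k$; (iii) $\check\beta(\delta y+X\eta)=\delta\check\beta(y)+\eta$ and $\check\Omega(\delta y+X\eta)=\delta^2\check\Omega(y)$ for all $y\in\mathbb{R}^n\setminus N$, $\delta\neq0$, $\eta\in\mathbb{R}^k$; (iv) $\check\Omega$ is $\lambda_{\mathbb{R}^n}$-almost everywhere nonsingular on $\mathbb{R}^n\setminus N$. Nonsphericity-corrected F-type test statistic: with $N^*=N\cup\{y\in\mathbb{R}^n\setminus N:\det\check\Omega(y)=0\}$, $T(y)=(R\check\beta(y)-r)'\check\Omega^{-1}(y)(R\check\beta(y)-r)$ for $y\in\mathbb{R}^n\setminus N^*$ and $T(y)=0$ for $y\in N^*$. *)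

theory Defs
  imports "HOL-Probability.Probability"
begin

text \<open>
  Sample size, number of regressors, number of restrictions and number of auxiliary
  regressors are the cardinalities of the finite index types 'n, 'k, 'q and 'm. Where the
  position of an index matters ('n and 'k), the index type is a linear order and the index
  \<open>i\<close> stands for the number \<open>pos i\<close>, counted from 1.
\<close>

definition pos :: "'a::{finite,linorder} \<Rightarrow> nat" where
  "pos i = card {j. j \<le> i}"

definition hcat ::
  "real^('k::finite)^'n \<Rightarrow> real^('m::finite)^'n \<Rightarrow> real^('k::finite + 'm::finite)^'n" where
  "hcat X U = (\<chi> i j. case j of Inl a \<Rightarrow> X $ i $ a | Inr b \<Rightarrow> U $ i $ b)"

definition col_space :: "real^'l^'n \<Rightarrow> (real^'n) set" where
  "col_space M = span (columns M)"

definition orth_proj :: "(real^'n) set \<Rightarrow> real^'n \<Rightarrow> real^'n" where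
  "orth_proj L y = (THE p. p \<in> L \<and> (\<forall>z\<in>L. orthogonal (y - p) z))"


subsection \<open>Spectral densities\<close>

text \<open>
  Functions on \<open>[-\<pi>, \<pi>]\<close> are represented by extensional functions, so that values outside
  the interval play no role.
\<close>

definition F_all :: "(real \<Rightarrow> real) set" where
  "F_all = {f \<in> extensional {-pi..pi}.
     (\<forall>\<omega>\<in>{-pi..pi}. 0 \<le> f \<omega> \<and> f (- \<omega>) = f \<omega>) \<and>
     integrable (lebesgue_on {-pi..pi}) f \<and>
     integral\<^sup>L (lebesgue_on {-pi..pi}) f = 1}"

text \<open>
  Spectral densities of stationary processes
  \<open>y\<^sub>t = a\<^sub>1 y\<^sub>t\<^sub>-\<^sub>1 + a\<^sub>2 y\<^sub>t\<^sub>-\<^sub>2 + \<epsilon>\<^sub>t\<close> with white noise \<open>\<epsilon>\<^sub>t\<close> of variance \<open>2\<pi>v > 0\<close>;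
  orders 0 and 1 are the cases \<open>a\<^sub>1 = a\<^sub>2 = 0\<close> and \<open>a\<^sub>2 = 0\<close>. Requiring the roots of the
  autoregressive polynomial to lie outside the closed unit disc, rather than merely off the
  unit circle, does not change the set: replacing a root inside the disc by its reflection at
  the circle changes the right-hand side only by a constant factor.
\<close>

definition F_AR2 :: "(real \<Rightarrow> real) set" where
  "F_AR2 = {f \<in> F_all. \<exists>a1 a2 v :: real. v > 0 \<and>
     (\<forall>z::complex. cmod z \<le> 1 \<longrightarrow> 1 - of_real a1 * z - of_real a2 * z\<^sup>2 \<noteq> 0) \<and>
     (\<forall>\<omega>\<in>{-pi..pi}. f \<omega> =
        v / (cmod (1 - of_real a1 * exp (- \<i> * of_real \<omega>)
                     - of_real a2 * exp (- 2 * \<i> * of_real \<omega>)))\<^sup>2)}"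

definition F_AR2_ext :: "(real \<Rightarrow> real) set" where
  "F_AR2_ext = {restrict (\<lambda>\<omega>. c1 * f \<omega> + c2 / (2 * pi)) {-pi..pi} | f c1 c2.
     f \<in> F_AR2 \<and> c1 \<ge> 0 \<and> c2 \<ge> 0 \<and> c1 + c2 = 1}"

text \<open>
  The real part only serves to obtain a real matrix, see \<open>Sigma_mat_entry\<close> below.
\<close>

definition Sigma_mat :: "(real \<Rightarrow> real) \<Rightarrow> real^('n::{finite,linorder})^('n::{finite,linorder})" where
  "Sigma_mat f = (\<chi> j l. Re (\<integral>\<omega>. exp (- \<i> * (of_nat (pos j) - of_nat (pos l)) * of_real \<omega>)
                              * of_real (f \<omega>) \<partial>lebesgue_on {-pi..pi}))"

lemma Sigma_mat_entry:
  fixes j l :: "'n::{finite,linorder}"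
  assumes "f \<in> F_all"
  shows "complex_of_real (Sigma_mat f $ j $ l) =
    (\<integral>\<omega>. exp (- \<i> * (of_nat (pos j) - of_nat (pos l)) * of_real \<omega>)
         * of_real (f \<omega>) \<partial>lebesgue_on {-pi..pi})"
proof -
  let ?M = "lebesgue_on {-pi..pi}"
  let ?h = "real (pos j) - real (pos l)"
  let ?g = "\<lambda>\<omega>. exp (- \<i> * (of_nat (pos j) - of_nat (pos l)) * of_real \<omega>) * complex_of_real (f \<omega>)"
  have Img: "Im (?g \<omega>) = - sin (?h * \<omega>) * f \<omega>" for \<omega>
    by (simp add: Im_exp)
  have "Im (integral\<^sup>L ?M ?g) = 0"
  proof (cases "integrable ?M ?g")
    case True
    let ?s = "\<lambda>\<omega>. - sin (?h * \<omega>) * f \<omega>"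
    have "Im (integral\<^sup>L ?M ?g) = integral\<^sup>L ?M ?s"
      using integral_Im[OF True] by (simp only: Img)
    moreover have "integral\<^sup>L ?M ?s = integral\<^sup>L ?M (\<lambda>\<omega>. ?s (- \<omega>))"
      using integral_reflect_real[of pi "-pi" ?s] by simp
    moreover have "integral\<^sup>L ?M (\<lambda>\<omega>. ?s (- \<omega>)) = integral\<^sup>L ?M (\<lambda>\<omega>. - ?s \<omega>)"
      using assms by (intro Bochner_Integration.integral_cong) (auto simp: F_all_def)
    ultimately show ?thesis by simp
  next
    case False
    then show ?thesis by (simp add: not_integrable_integral_eq)
  qed
  then show ?thesis
    by (simp add: Sigma_mat_def complex_eq_iff)
qed


subsection \<open>Gaussian measures\<close>

definition std_gaussian :: "(real^'n) measure" where
  "std_gaussian = density lborel (\<lambda>z. ennreal (\<Prod>i\<in>UNIV. std_normal_density (z $ i)))"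

text \<open>
  The law of \<open>\<mu> + L Z\<close> with \<open>Z\<close> standard normal and \<open>L L' = B\<close>. Such an \<open>L\<close> exists for every
  symmetric nonnegative definite \<open>B\<close>, and the law does not depend on the choice of \<open>L\<close>.
\<close>

definition gaussian :: "real^'n \<Rightarrow> real^'n^'n \<Rightarrow> (real^'n) measure" where
  "gaussian \<mu> B =
     distr std_gaussian borel (\<lambda>z. \<mu> + (SOME L :: real^'n^'n. L ** transpose L = B) *v z)"


subsection \<open>Estimators\<close>

definition beta_hat :: "real^'l^'n \<Rightarrow> real^'n \<Rightarrow> real^'l" where
  "beta_hat Z y = matrix_inv (transpose Z ** Z) *v (transpose Z *v y)"

definition A_mat :: "real^('n::{finite,linorder})^('n::{finite,linorder})" where
  "A_mat = (\<chi> i j. if j \<le> i then 1 else 0)"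

definition s2 :: "real^'n^'n \<Rightarrow> real^'l^'n \<Rightarrow> real^'n \<Rightarrow> real" where
  "s2 D1 D2 y = (1 / real CARD('n)) *
     (y \<bullet> (transpose D1 *v orth_proj ((col_space (D1 ** D2))\<^sup>\<bottom>) (D1 *v y)))"

definition G_mat :: "real^('k::finite + 'm)^('m::finite)" where
  "G_mat = (\<chi> i j. case j of Inl _ \<Rightarrow> 0 | Inr b \<Rightarrow> if b = i then 1 else 0)"

text \<open>
  \<open>J_mid D X U y\<close> is the matrix \<open>s\<^sup>2\<^sub>D\<^sub>,\<^sub>Z(y) G (Z' D' D Z)\<^sup>-\<^sup>1 G'\<close> with \<open>Z = (X, U)\<close>.
  The statistic \<open>J\<^sup>1\<close> is the case where \<open>D\<close> is the identity, \<open>J\<^sup>2\<close> is the case \<open>D = A\<close>.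
\<close>

definition J_mid :: "real^'n^'n \<Rightarrow> real^'k^'n \<Rightarrow> real^'m^'n \<Rightarrow> real^'n \<Rightarrow> real^'m^'m" where
  "J_mid D X U y = (let Z = hcat X U; G = (G_mat :: real^('k::finite + 'm)^('m::finite)) in
     s2 D Z y *\<^sub>R (G ** matrix_inv (transpose Z ** transpose D ** D ** Z) ** transpose G))"

definition J_gen :: "real^'n^'n \<Rightarrow> real^'k^'n \<Rightarrow> real^'m^'n \<Rightarrow> real^'n \<Rightarrow> real" where
  "J_gen D X U y =
     (let b = (G_mat :: real^('k::finite + 'm)^('m::finite)) *v beta_hat (D ** hcat X U) (D *v y) in
      (1 / real CARD('n)) * (b \<bullet> (matrix_inv (J_mid D X U y) *v b)))"

definition J_weight :: "nat \<Rightarrow> real^('n::{finite,linorder})^('n::{finite,linorder})" where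
  "J_weight i = (if i = 1 then mat 1 else A_mat)"

definition J_stat ::
  "nat \<Rightarrow> real^'k^('n::{finite,linorder}) \<Rightarrow> real^'m^('n::{finite,linorder}) \<Rightarrow> real^('n::{finite,linorder}) \<Rightarrow> real" where
  "J_stat i X U y = J_gen (J_weight i) X U y"

definition j_exp :: "real^('n::{finite,linorder})^('n::{finite,linorder}) \<Rightarrow> int" where
  "j_exp V = (if V = A_mat then 1 else -1)"

definition beta_V :: "real^'n^'n \<Rightarrow> real^'k^'n \<Rightarrow> real^'n \<Rightarrow> real^'k" where
  "beta_V V X y = beta_hat (V ** X) (V *v y)"

definition Omega_Vo ::
  "real \<Rightarrow> real^'m^('n::{finite,linorder}) \<Rightarrow> nat \<Rightarrow> real^('n::{finite,linorder})^('n::{finite,linorder}) \<Rightarrow> real^'k^('n::{finite,linorder}) \<Rightarrow> real^'k^'q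
    \<Rightarrow> real^('n::{finite,linorder}) \<Rightarrow> real^'q^'q" where
  "Omega_Vo c U i V X R y =
     (real CARD('n) powi j_exp V * s2 A_mat X y * exp (c * J_stat i X U y)) *\<^sub>R
     (R ** matrix_inv (transpose X ** transpose V ** V ** X) ** transpose R)"

text \<open>
  Since \<open>matrix_inv\<close> is total, well-definedness of the estimators at \<open>y\<close> is expressed by
  invertibility of all the matrices that are inverted in their definition.
\<close>

definition beta_V_defined :: "real^'n^'n \<Rightarrow> real^'k^'n \<Rightarrow> bool" where
  "beta_V_defined V X \<longleftrightarrow> invertible (transpose (V ** X) ** (V ** X))"

definition Omega_Vo_defined ::
  "real^'m^('n::{finite,linorder}) \<Rightarrow> nat \<Rightarrow> real^('n::{finite,linorder})^('n::{finite,linorder}) \<Rightarrow> real^'k^('n::{finite,linorder}) \<Rightarrow> real^('n::{finite,linorder}) \<Rightarrow> bool" where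
  "Omega_Vo_defined U i V X y \<longleftrightarrow>
     (let D = J_weight i; Z = hcat X U in
       invertible (transpose (D ** Z) ** (D ** Z)) \<and>
       invertible (J_mid D X U y) \<and>
       invertible (transpose X ** transpose V ** V ** X))"

definition estimator_conditions ::
  "real^'k^'n \<Rightarrow> (real^'n \<Rightarrow> real^'k) \<Rightarrow> (real^'n \<Rightarrow> real^'q^'q) \<Rightarrow> (real^'n) set \<Rightarrow> bool" where
  "estimator_conditions X \<beta> \<Omega> N \<longleftrightarrow>
     closed N \<and> N \<in> null_sets lborel \<and>
     continuous_on (- N) \<beta> \<and> continuous_on (- N) \<Omega> \<and>
     (\<forall>y. y \<notin> N \<longrightarrow> transpose (\<Omega> y) = \<Omega> y) \<and>
     (\<forall>y \<delta> \<eta>. y \<notin> N \<and> \<delta> \<noteq> 0 \<longrightarrow> \<delta> *\<^sub>R y + X *v \<eta> \<notin> N) \<and>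
     (\<forall>y \<delta> \<eta>. y \<notin> N \<and> \<delta> \<noteq> 0 \<longrightarrow>
        \<beta> (\<delta> *\<^sub>R y + X *v \<eta>) = \<delta> *\<^sub>R \<beta> y + \<eta> \<and>
        \<Omega> (\<delta> *\<^sub>R y + X *v \<eta>) = \<delta>\<^sup>2 *\<^sub>R \<Omega> y) \<and>
     (AE y in lborel. y \<notin> N \<longrightarrow> invertible (\<Omega> y))"


subsection \<open>Test statistic and hypotheses\<close>

definition N_star :: "(real^'n \<Rightarrow> real^'q^'q) \<Rightarrow> (real^'n) set \<Rightarrow> (real^'n) set" where
  "N_star \<Omega> N = N \<union> {y \<in> - N. det (\<Omega> y) = 0}"

definition F_type_stat ::
  "real^'k^'q \<Rightarrow> real^'q \<Rightarrow> (real^'n \<Rightarrow> real^'k) \<Rightarrow> (real^'n \<Rightarrow> real^'q^'q) \<Rightarrow> (real^'n) set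
    \<Rightarrow> real^'n \<Rightarrow> real" where
  "F_type_stat R r \<beta> \<Omega> N y =
     (if y \<in> N_star \<Omega> N then 0
      else (R *v \<beta> y - r) \<bullet> (matrix_inv (\<Omega> y) *v (R *v \<beta> y - r)))"

definition M0 :: "real^'k^'n \<Rightarrow> real^'k^'q \<Rightarrow> real^'q \<Rightarrow> (real^'n) set" where
  "M0 X R r = {X *v b | b. R *v b = r}"

text \<open>
  The first \<open>kF\<close> columns of \<open>X\<close> form the matrix \<open>F\<close> of polynomial trends; the remaining ones,
  of which there are none if \<open>kF = CARD('k)\<close>, are unrestricted.
\<close>

definition polynomial_trend ::
  "real^('k::{finite,linorder})^('n::{finite,linorder}) \<Rightarrow> real^('k::{finite,linorder})^'q \<Rightarrow> nat \<Rightarrow> bool" where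
  "polynomial_trend X R kF \<longleftrightarrow>
     1 \<le> kF \<and> kF \<le> CARD('k) \<and>
     (\<forall>i j. pos j \<le> kF \<longrightarrow> X $ i $ j = real (pos i) ^ (pos j - 1)) \<and>
     (\<exists>l. pos l \<le> kF \<and> column l R \<noteq> 0)"

end

theory Submission
  imports Defs
begin

text \<open>
  Off \<open>N\<close> the statistic is \<open>\<rho>' W\<^sup>-\<^sup>1 \<rho> / s\<close> with \<open>\<rho> = R \<beta>(y) - r\<close>, a fixed positive definite \<open>W\<close>
  and a scale \<open>s\<close> made of squared residuals and an exponential of \<open>J\<close>. Write \<open>y = \<mu>\<^sub>0 + u\<close> with
  \<open>u\<close> centred Gaussian and let \<open>l\<close> be the first nonzero column of \<open>R\<close>, \<open>l \<le> k\<^sub>F\<close>. For an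
  autoregressive density of order two peaked at a small frequency \<open>\<omega>\<close> the sample consists
  essentially of \<open>cos (j \<omega>)\<close> and \<open>sin (j \<omega>)\<close>; Taylor expansion in \<open>\<omega>\<close> shows that its polynomial
  part moves \<open>\<rho>\<close> by an amount of order \<open>\<omega>\<^sup>l\<^sup>-\<^sup>1\<close>, whereas residuals and auxiliary coefficients,
  which annihilate polynomials of degree less than \<open>k\<^sub>F\<close>, are of order \<open>\<omega>\<close> to the power \<open>k\<^sub>F\<close>.
  White noise of the latter size is mixed in, so that the auxiliary regression residuals do not
  degenerate and \<open>J\<close> stays bounded in probability. Hence the statistic tends to infinity in
  probability as \<open>\<omega> \<rightarrow> 0\<close>. Only second moments and the anti-concentration
  of one-dimensional Gaussian projections enter, so no limit of measures has to be taken.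
\<close>

subsection \<open>The Gaussian measures\<close>

lemma emeasure_std_gaussian_box:
  fixes A :: "'n::finite \<Rightarrow> real set"
  assumes "\<And>i. A i \<in> sets borel"
  shows "emeasure (std_gaussian :: (real^'n) measure) {z. \<forall>i. z $ i \<in> A i} =
    (\<Prod>i\<in>UNIV. emeasure (density lborel std_normal_density) (A i))"
proof -
  \<comment> \<open>The product formula for \<open>lborel\<close> multiplies over basis vectors
    rather than indices, so \<open>g\<close> is indexed by \<open>Basis\<close> and
    \<open>axis_index\<close> recovers the coordinate.\<close>
  define g :: "real^'n \<Rightarrow> real \<Rightarrow> real" where
    "g b x = std_normal_density x * indicator (A (axis_index b)) x" for b x
  have Basis_eq: "(Basis :: (real^'n) set) = (\<lambda>i. axis i 1) ` UNIV"
    by (auto simp: Basis_vec_def)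
  have inj: "inj (\<lambda>i. axis i 1 :: real^'n)"
    by (auto simp: inj_on_def axis_eq_axis)
  have idx: "axis_index (axis i 1 :: real^'n) = i" for i
    by (simp add: axis_index_def axis_eq_axis)
  have box: "{z :: real^'n. \<forall>i. z $ i \<in> A i} \<in> sets borel"
    using assms by measurable
  have g_mono: "\<And>b x. 0 \<le> g b x"
    by (simp add: g_def)
  have g_meas: "g b \<in> borel_measurable borel" for b
    unfolding g_def using assms by measurable
  have ind: "indicator {z :: real^'n. \<forall>i. z $ i \<in> A i} z = (\<Prod>i\<in>UNIV. indicator (A i) (z $ i) :: real)" for z :: "real^'n"
    by (auto simp: indicator_def intro!: prod.neutral[symmetric] prod_zero[symmetric])
  have "emeasure std_gaussian {z :: real^'n. \<forall>i. z $ i \<in> A i} =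
    (\<integral>\<^sup>+z. ennreal (\<Prod>b\<in>Basis. g b (z \<bullet> b)) \<partial>lborel)"
    unfolding std_gaussian_def using box
    by (subst emeasure_density, simp_all)
       (auto simp: Basis_eq prod.reindex[OF inj] inner_axis idx g_def prod.distrib ind[symmetric]
             simp flip: ennreal_mult'' intro!: nn_integral_cong split: split_indicator)
  also have "\<dots> = (\<integral>\<^sup>+z. (\<Prod>b\<in>Basis. ennreal (g b (z \<bullet> b))) \<partial>lborel)"
    by (simp add: prod_ennreal g_mono)
  also have "\<dots> = (\<Prod>b\<in>(Basis::(real^'n) set). \<integral>\<^sup>+x. ennreal (g b x) \<partial>lborel)"
    by (rule nn_integral_lborel_prod) (use g_meas in auto)
  also have "\<dots> = (\<Prod>i\<in>(UNIV::'n set). \<integral>\<^sup>+x. ennreal (std_normal_density x) * indicator (A i) x \<partial>lborel)"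
    by (auto simp: Basis_eq prod.reindex[OF inj] idx g_def ennreal_mult'' ennreal_indicator
             intro!: prod.cong nn_integral_cong split: split_indicator)
  also have "\<dots> = (\<Prod>i\<in>UNIV. emeasure (density lborel std_normal_density) (A i))"
    using assms by (intro prod.cong) (simp_all add: emeasure_density)
  finally show ?thesis .
qed

lemma space_std_gaussian [simp]: "space std_gaussian = UNIV"
  and sets_std_gaussian [measurable_cong, simp]: "sets std_gaussian = sets borel"
  by (simp_all add: std_gaussian_def)

lemma prob_space_std_normal: "prob_space (density lborel std_normal_density)"
  by (rule prob_space_normal_density) simp

lemma prob_space_std_gaussian: "prob_space (std_gaussian :: (real^'n) measure)"
proof (rule prob_spaceI)
  show "emeasure (std_gaussian :: (real^'n) measure) (space std_gaussian) = 1"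
    using emeasure_std_gaussian_box[of "\<lambda>_. UNIV"] prob_space.emeasure_space_1[OF prob_space_std_normal]
    by simp
qed

lemma measure_std_gaussian_box:
  fixes A :: "'n::finite \<Rightarrow> real set"
  assumes "\<And>i. A i \<in> sets borel"
  shows "measure (std_gaussian :: (real^'n) measure) {z. \<forall>i. z $ i \<in> A i} =
    (\<Prod>i\<in>UNIV. measure (density lborel std_normal_density) (A i))"
proof -
  interpret N: prob_space "density lborel std_normal_density" by (rule prob_space_std_normal)
  interpret G: prob_space "std_gaussian :: (real^'n) measure" by (rule prob_space_std_gaussian)
  show ?thesis
    using emeasure_std_gaussian_box[of A] assms
    by (simp add: N.emeasure_eq_measure G.emeasure_eq_measure prod_ennreal prod_nonneg)
qed

lemma measure_std_gaussian_component:
  assumes "A \<in> sets borel"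
  shows "measure (std_gaussian :: (real^'n) measure) {z. z $ j \<in> A} =
    measure (density lborel std_normal_density) A"
proof -
  interpret N: prob_space "density lborel std_normal_density" by (rule prob_space_std_normal)
  have "{z :: real^'n. z $ j \<in> A} = {z. \<forall>i. z $ i \<in> (if i = j then A else UNIV)}"
    by auto
  then have "measure (std_gaussian :: (real^'n) measure) {z. z $ j \<in> A} =
    (\<Prod>i\<in>UNIV. measure (density lborel std_normal_density) (if i = j then A else UNIV))"
    using assms by (simp only:) (rule measure_std_gaussian_box, simp)
  also have "\<dots> = (\<Prod>i\<in>UNIV. if i = j then measure (density lborel std_normal_density) A else 1)"
    using N.prob_space by (intro prod.cong) auto
  finally show ?thesis by simp
qed

lemma distributed_std_gaussian_component:
  "distributed (std_gaussian :: (real^'n) measure) lborel (\<lambda>z. z $ j) std_normal_density"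
proof -
  interpret N: prob_space "density lborel std_normal_density" by (rule prob_space_std_normal)
  interpret G: prob_space "std_gaussian :: (real^'n) measure" by (rule prob_space_std_gaussian)
  have "distr (std_gaussian :: (real^'n) measure) lborel (\<lambda>z. z $ j) = density lborel std_normal_density"
  proof (rule measure_eqI)
    fix A assume "A \<in> sets (distr (std_gaussian :: (real^'n) measure) lborel (\<lambda>z. z $ j))"
    then have A: "A \<in> sets borel" by simp
    show "emeasure (distr (std_gaussian :: (real^'n) measure) lborel (\<lambda>z. z $ j)) A =
      emeasure (density lborel std_normal_density) A"
      using A measure_std_gaussian_component[OF A, of j]
      by (subst emeasure_distr) (auto simp: G.emeasure_eq_measure N.emeasure_eq_measure vimage_def)
  qed simp
  then show ?thesis by (simp add: distributed_def)
qed

text \<open>An intersection of coordinate events over \<open>J\<close> is again a box, with side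
  \<open>UNIV\<close> in every remaining coordinate, and such sides contribute a factor 1.\<close>

lemma indep_vars_std_gaussian:
  "prob_space.indep_vars (std_gaussian :: (real^'n) measure) (\<lambda>_. borel) (\<lambda>i z. z $ i) UNIV"
proof -
  interpret N: prob_space "density lborel std_normal_density" by (rule prob_space_std_normal)
  interpret G: prob_space "std_gaussian :: (real^'n) measure" by (rule prob_space_std_gaussian)
  show ?thesis
    unfolding G.indep_vars_def2
  proof (intro conjI ballI G.indep_setsI)
    fix A :: "'n \<Rightarrow> (real^'n) set" and J
    assume J: "J \<noteq> {}" and "\<forall>j\<in>J. A j \<in> {(\<lambda>z. z $ j) -` B \<inter> space std_gaussian |B. B \<in> sets borel}"
    then have "\<forall>j\<in>J. \<exists>B. B \<in> sets borel \<and> A j = {z. z $ j \<in> B}"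
      by (fastforce simp: vimage_def)
    then obtain B where B: "\<And>j. j \<in> J \<Longrightarrow> B j \<in> sets borel" "\<And>j. j \<in> J \<Longrightarrow> A j = {z. z $ j \<in> B j}"
      by metis
    have "(\<Inter>j\<in>J. A j) = {z. \<forall>i. z $ i \<in> (if i \<in> J then B i else UNIV)}"
      using B(2) by auto
    then have "measure std_gaussian (\<Inter>j\<in>J. A j) =
      (\<Prod>i\<in>UNIV. measure (density lborel std_normal_density) (if i \<in> J then B i else UNIV))"
      using B(1) by (simp only:) (rule measure_std_gaussian_box, simp)
    also have "\<dots> = (\<Prod>i\<in>J. measure (density lborel std_normal_density) (B i))"
      using N.prob_space by (intro prod.mono_neutral_cong_right) auto
    also have "\<dots> = (\<Prod>j\<in>J. measure std_gaussian (A j))"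
      using B by (simp add: measure_std_gaussian_component)
    finally show "measure std_gaussian (\<Inter>j\<in>J. A j) = (\<Prod>j\<in>J. measure std_gaussian (A j))" .
  qed (auto intro!: measurable_sets_borel)
qed

section \<open>One-dimensional projections: law, small balls, tails\<close>

lemma distributed_inner_std_gaussian:
  fixes u :: "real^'n"
  assumes "u \<noteq> 0"
  shows "distributed std_gaussian lborel (\<lambda>z. u \<bullet> z) (normal_density 0 (norm u))"
proof -
  interpret G: prob_space "std_gaussian :: (real^'n) measure" by (rule prob_space_std_gaussian)
  \<comment> \<open>Coordinates with coefficient 0 are left out because a constant has no normal
    density.\<close>
  define I where "I = {i. u $ i \<noteq> 0}"
  have "I \<noteq> {}" using assms by (auto simp: I_def vec_eq_iff)
  have "G.indep_vars (\<lambda>_. borel) (\<lambda>i. (\<lambda>x. u $ i * x) \<circ> (\<lambda>z. z $ i)) I"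
    by (rule G.indep_vars_compose[OF G.indep_vars_subset[OF indep_vars_std_gaussian]]) auto
  then have ind: "G.indep_vars (\<lambda>_. borel) (\<lambda>i z. u $ i * z $ i) I"
    by (simp add: comp_def)
  have d: "distributed std_gaussian lborel (\<lambda>z. u $ i * z $ i) (normal_density 0 \<bar>u $ i\<bar>)"
    if "i \<in> I" for i
    using G.normal_density_affine[OF distributed_std_gaussian_component, of "u $ i" 0 i] that
    by (simp add: I_def)
  have "distributed std_gaussian lborel (\<lambda>z. \<Sum>i\<in>I. u $ i * z $ i)
      (normal_density (\<Sum>i\<in>I. 0) (sqrt (\<Sum>i\<in>I. \<bar>u $ i\<bar>\<^sup>2)))"
    using \<open>I \<noteq> {}\<close> by (intro G.sum_indep_normal ind d) (auto simp: I_def)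
  moreover have "(\<Sum>i\<in>I. u $ i * z $ i) = u \<bullet> z" for z
    unfolding inner_vec_def by (rule sum.mono_neutral_cong_left) (auto simp: I_def)
  moreover have "sqrt (\<Sum>i\<in>I. \<bar>u $ i\<bar>\<^sup>2) = norm u"
    unfolding norm_vec_def L2_set_def by (rule arg_cong[of _ _ sqrt], rule sum.mono_neutral_cong_left) (auto simp: I_def)
  ultimately show ?thesis by simp
qed

text \<open>Anti-concentration: the normal density is at most \<open>1 / (2 * norm u)\<close>,
  because \<open>sqrt (2 * pi)\<close> is at least 2, and the interval has length
  \<open>2 * d\<close>.\<close>

lemma std_gaussian_small_ball:
  fixes u :: "real^'n"
  assumes "u \<noteq> 0" "0 \<le> d"
  shows "measure std_gaussian {z. \<bar>u \<bullet> z\<bar> < d} \<le> d / norm u"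
proof -
  interpret G: prob_space "std_gaussian :: (real^'n) measure" by (rule prob_space_std_gaussian)
  note D = distributed_inner_std_gaussian[OF assms(1)]
  have bound: "normal_density 0 (norm u) x \<le> 1 / (2 * norm u)" for x
  proof -
    have "2 * norm u \<le> sqrt (2 * pi) * norm u"
      using pi_gt3 by (intro mult_right_mono real_le_rsqrt) auto
    then have "1 / sqrt (2 * pi * (norm u)\<^sup>2) \<le> 1 / (2 * norm u)"
      using assms(1) by (intro divide_left_mono) (auto simp: real_sqrt_mult)
    moreover have "exp (- (x - 0)\<^sup>2 / (2 * (norm u)\<^sup>2)) \<le> 1" by simp
    ultimately show ?thesis
      unfolding normal_density_def using mult_mono[of "1 / sqrt (2 * pi * (norm u)\<^sup>2)" "1 / (2 * norm u)" "exp (- (x - 0)\<^sup>2 / (2 * (norm u)\<^sup>2))" 1]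
      by simp
  qed
  have "emeasure std_gaussian {z. \<bar>u \<bullet> z\<bar> < d} = (\<integral>\<^sup>+x. ennreal (normal_density 0 (norm u) x) * indicator {-d<..<d} x \<partial>lborel)"
    using distributed_emeasure[OF D, of "{-d<..<d}"]
    by (simp add: vimage_def abs_less_iff conj_commute minus_less_iff)
  also have "\<dots> \<le> (\<integral>\<^sup>+x. ennreal (1 / (2 * norm u)) * indicator {-d<..<d} x \<partial>lborel)"
    by (intro nn_integral_mono mult_right_mono ennreal_leI bound) auto
  also have "\<dots> = ennreal (1 / (2 * norm u)) * ennreal (2 * d)"
    using assms(2) by (simp add: nn_integral_cmult_indicator)
  also have "\<dots> = ennreal (d / norm u)"
    using assms by (simp flip: ennreal_mult'')
  finally show ?thesis
    using assms by (simp add: G.emeasure_eq_measure)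
qed

lemma std_gaussian_tail:
  fixes u :: "real^'n"
  assumes "0 < s"
  shows "measure std_gaussian {z. s \<le> \<bar>u \<bullet> z\<bar>} \<le> (norm u)\<^sup>2 / s\<^sup>2"
proof (cases "u = 0")
  case True
  then show ?thesis using assms by simp
next
  case False
  interpret G: prob_space "std_gaussian :: (real^'n) measure" by (rule prob_space_std_gaussian)
  note D = distributed_inner_std_gaussian[OF False]
  have E: "G.expectation (\<lambda>z. u \<bullet> z) = 0"
    using G.normal_distributed_expectation[OF _ D] False by simp
  have V: "G.variance (\<lambda>z. u \<bullet> z) = (norm u)\<^sup>2"
    using G.normal_distributed_variance[OF _ D] False by simp
  \<comment> \<open>Without integrability the Bochner integral would be 0 by convention,
    contradicting the positive variance.\<close>
  have "integrable std_gaussian (\<lambda>z. (u \<bullet> z)\<^sup>2)"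
  proof (rule ccontr)
    assume "\<not> integrable std_gaussian (\<lambda>z. (u \<bullet> z)\<^sup>2)"
    then show False using V False by (simp add: E not_integrable_integral_eq)
  qed
  from G.Chebyshev_inequality[OF _ this assms] show ?thesis
    unfolding E using V E by simp
qed

section \<open>Factors of covariance matrices and bounds for general Gaussian laws\<close>

lemma Cholesky_exists:
  fixes B :: "real^'n^'n"
  assumes "transpose B = B" "\<And>x. 0 \<le> x \<bullet> (B *v x)"
  shows "\<exists>L :: real^'n^'n. L ** transpose L = B"
proof -
  \<comment> \<open>Induction on the set \<open>S\<close> of indices that carry \<open>B\<close>.
    Asking \<open>L\<close> to have zero columns outside \<open>S\<close> leaves column
    \<open>p\<close> free when \<open>p\<close> is added.\<close>
  have "\<exists>L :: real^'n^'n. (\<forall>i k. k \<notin> S \<longrightarrow> L $ i $ k = 0) \<and> L ** transpose L = B"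
    if "finite S" "transpose B = B" "\<And>x. 0 \<le> x \<bullet> (B *v x)"
      "\<And>i j. i \<notin> S \<or> j \<notin> S \<Longrightarrow> B $ i $ j = 0" for S and B :: "real^'n^'n"
    using that
  proof (induction S arbitrary: B rule: finite_induct)
    case empty
    then have "B = 0" by (simp add: vec_eq_iff)
    then show ?case by (intro exI[of _ 0]) simp
  next
    case (insert p S)
    have sym: "B $ i $ j = B $ j $ i" for i j
      using insert.prems(1) by (metis transpose_def vec_lambda_beta)
    define b where "b = column p B"
    have b: "b $ i = B $ i $ p" for i by (simp add: b_def column_def)
    have Bp: "B *v axis p 1 = b" by (simp add: b_def matrix_vector_mul_component vec_eq_iff column_def inner_axis)
    have xBp: "x \<bullet> (B *v axis p 1) = axis p 1 \<bullet> (B *v x)" for x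
      by (metis dot_lmul_matrix insert.prems(1) inner_commute transpose_matrix_vector)
    have pb: "axis p 1 \<bullet> (B *v x) = b \<bullet> x" for x
      using xBp[of x] by (simp add: Bp inner_commute)
    have quad: "0 \<le> x \<bullet> (B *v x) - 2 * t * (b \<bullet> x) + t\<^sup>2 * B $ p $ p" for t x
    proof -
      have "(x - t *\<^sub>R axis p 1) \<bullet> (B *v (x - t *\<^sub>R axis p 1)) =
        x \<bullet> (B *v x) - 2 * t * (b \<bullet> x) + t\<^sup>2 * B $ p $ p"
        using pb[of x]
        by (simp add: matrix_vector_mult_diff_distrib matrix_vector_mult_scaleR inner_diff_left inner_diff_right
            Bp inner_commute[of x b] inner_axis' b power2_eq_square algebra_simps)
      then show ?thesis using insert.prems(2) by metis
    qed
    have bpp: "b $ p = B $ p $ p" by (simp add: b)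
    have Bpp: "0 \<le> B $ p $ p" using quad[of 0 1] by simp
    show ?case
    proof (cases "B $ p $ p = 0")
      case True
      \<comment> \<open>With a zero pivot the expression in \<open>quad\<close> is affine in
        \<open>t\<close> and stays nonnegative only if its slope vanishes, so row and column
        \<open>p\<close> are zero.\<close>
      have "b \<bullet> x = 0" for x
      proof (rule ccontr)
        assume "b \<bullet> x \<noteq> 0"
        then have "x \<bullet> (B *v x) - 2 * ((x \<bullet> (B *v x) + 1) / (2 * (b \<bullet> x))) * (b \<bullet> x) = -1"
          by (simp add: field_simps)
        with quad[of x "(x \<bullet> (B *v x) + 1) / (2 * (b \<bullet> x))"] True show False by simp
      qed
      then have "b = 0" by (metis inner_eq_zero_iff)
      then have "B $ i $ p = 0" for i using b[of i] by simp
      then have "\<And>i j. i \<notin> S \<or> j \<notin> S \<Longrightarrow> B $ i $ j = 0"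
        using insert.prems(3) sym by (metis insertE)
      from insert.IH[OF insert.prems(1,2) this] show ?thesis by auto
    next
      case False
      then have pos: "0 < B $ p $ p" using Bpp by simp
      \<comment> \<open>The Schur complement of the pivot: subtracting this rank one matrix clears
        row and column \<open>p\<close>.\<close>
      define B' where "B' = (\<chi> i j. B $ i $ j - b $ i * b $ j / B $ p $ p)"
      have "transpose B' = B'"
        by (simp add: B'_def transpose_def vec_eq_iff sym)
      moreover have "0 \<le> x \<bullet> (B' *v x)" for x
      proof -
        have "x \<bullet> (B' *v x) = x \<bullet> (B *v x) - (b \<bullet> x)\<^sup>2 / B $ p $ p"
          by (simp add: B'_def inner_vec_def matrix_vector_mult_def left_diff_distrib sum_subtractf right_diff_distrib
              power2_eq_square sum_product sum_distrib_left sum_divide_distrib mult_ac)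
        \<comment> \<open>The value of \<open>t\<close> inserted into \<open>quad\<close> is its
          minimiser.\<close>
        moreover have "\<dots> \<ge> 0"
          using quad[of x "(b \<bullet> x) / B $ p $ p"] pos by (simp add: field_simps power2_eq_square)
        ultimately show ?thesis by simp
      qed
      moreover have "B' $ i $ j = 0" if "i \<notin> S \<or> j \<notin> S" for i j
      proof (cases "i = p \<or> j = p")
        case True
        then show ?thesis using pos by (auto simp: B'_def b sym)
      next
        case False
        then have "i \<notin> insert p S \<or> j \<notin> insert p S" using that by auto
        then show ?thesis using insert.prems(3) that \<open>\<not> (i = p \<or> j = p)\<close> by (auto simp: B'_def b)
      qed
      ultimately obtain L :: "real^'n^'n" where L: "\<And>i k. k \<notin> S \<Longrightarrow> L $ i $ k = 0" "L ** transpose L = B'"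
        using insert.IH[of B'] by blast
      define L' where "L' = (\<chi> i k. if k = p then b $ i / sqrt (B $ p $ p) else L $ i $ k)"
      have "(L' ** transpose L') $ i $ j = B $ i $ j" for i j
      proof -
        have "(L' ** transpose L') $ i $ j = (\<Sum>k\<in>UNIV. (if k = p then b $ i * b $ j / B $ p $ p else 0) + L $ i $ k * L $ j $ k)"
          unfolding matrix_matrix_mult_def transpose_def using pos L(1)[OF insert.hyps(2)]
          by (auto simp: L'_def intro!: sum.cong)
        also have "\<dots> = b $ i * b $ j / B $ p $ p + (L ** transpose L) $ i $ j"
          by (simp add: sum.distrib matrix_matrix_mult_def transpose_def)
        finally show ?thesis by (simp add: L(2) B'_def)
      qed
      moreover have "\<forall>i k. k \<notin> insert p S \<longrightarrow> L' $ i $ k = 0"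
        using L(1) by (auto simp: L'_def)
      ultimately show ?thesis by (intro exI[of _ L']) (auto simp: vec_eq_iff)
    qed
  qed
  from this[of UNIV B] assms show ?thesis by auto
qed

text \<open>\<open>gaussian\<close> picks its factor by \<open>SOME\<close>, so nothing is known
  about the chosen matrix until a factor is shown to exist. Later estimates use it only through
  \<open>norm (transpose L *v a)\<close>.\<close>

lemma gaussian_eq_distr:
  fixes B :: "real^'n^'n"
  assumes "transpose B = B" "\<And>x. 0 \<le> x \<bullet> (B *v x)"
  obtains L :: "real^'n^'n" where "\<And>a. (norm (transpose L *v a))\<^sup>2 = a \<bullet> (B *v a)"
    "\<And>\<mu>. gaussian \<mu> B = distr std_gaussian borel (\<lambda>z. \<mu> + L *v z)"
proof
  let ?L = "SOME L :: real^'n^'n. L ** transpose L = B"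
  have "?L ** transpose ?L = B"
    using Cholesky_exists[OF assms] by (rule someI_ex)
  moreover have "(norm (transpose ?L *v a))\<^sup>2 = a \<bullet> ((?L ** transpose ?L) *v a)" for a
    unfolding power2_norm_eq_inner matrix_vector_mul_assoc[symmetric] dot_lmul_matrix[symmetric]
    by (simp only: transpose_matrix_vector)
  ultimately show "(norm (transpose ?L *v a))\<^sup>2 = a \<bullet> (B *v a)" for a
    by simp
qed (simp add: gaussian_def)

lemma measurable_affine_gaussian [measurable]:
  "(\<lambda>z. \<mu> + L *v z) \<in> borel_measurable (std_gaussian :: (real^'n) measure)" for L :: "real^'n^'n"
  unfolding measurable_cong_sets[OF sets_std_gaussian refl]
  by (intro borel_measurable_continuous_onI continuous_intros)

lemma prob_space_gaussian: "prob_space (gaussian \<mu> B)"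
  unfolding gaussian_def by (intro prob_space.prob_space_distr prob_space_std_gaussian) measurable

lemma sets_gaussian [simp]: "sets (gaussian \<mu> B) = sets borel"
  and space_gaussian [simp]: "space (gaussian \<mu> B) = UNIV"
  by (simp_all add: gaussian_def)

text \<open>The centred projection on \<open>a\<close> is the standard Gaussian projected on
  \<open>transpose L *v a\<close>, with variance \<open>a \<bullet> (B *v a)\<close>;
  \<open>gaussian_tail\<close> rests on the same identity.\<close>

lemma gaussian_small_ball:
  fixes B :: "real^'n^'n"
  assumes "transpose B = B" "\<And>x. 0 \<le> x \<bullet> (B *v x)" "0 < a \<bullet> (B *v a)" "0 \<le> d"
  shows "measure (gaussian \<mu> B) {y. \<bar>a \<bullet> (y - \<mu>)\<bar> < d} \<le> d / sqrt (a \<bullet> (B *v a))"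
proof -
  obtain L :: "real^'n^'n" where L: "\<And>a. (norm (transpose L *v a))\<^sup>2 = a \<bullet> (B *v a)"
    "\<And>\<mu>. gaussian \<mu> B = distr std_gaussian borel (\<lambda>z. \<mu> + L *v z)"
    using gaussian_eq_distr[OF assms(1,2)] by metis
  have eq: "a \<bullet> (L *v z) = (transpose L *v a) \<bullet> z" for z
    by (metis dot_lmul_matrix transpose_matrix_vector)
  have "measure (gaussian \<mu> B) {y. \<bar>a \<bullet> (y - \<mu>)\<bar> < d} = measure std_gaussian {z. \<bar>(transpose L *v a) \<bullet> z\<bar> < d}"
    unfolding L(2) by (subst measure_distr) (auto simp: vimage_def eq)
  also have "\<dots> \<le> d / norm (transpose L *v a)"
    using assms L(1)[of a] by (intro std_gaussian_small_ball) auto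
  also have "norm (transpose L *v a) = sqrt (a \<bullet> (B *v a))"
    using L(1)[of a] by (metis norm_ge_zero real_sqrt_unique)
  finally show ?thesis .
qed

lemma gaussian_tail:
  fixes B :: "real^'n^'n"
  assumes "transpose B = B" "\<And>x. 0 \<le> x \<bullet> (B *v x)" "0 < s"
  shows "measure (gaussian \<mu> B) {y. s \<le> \<bar>a \<bullet> (y - \<mu>)\<bar>} \<le> (a \<bullet> (B *v a)) / s\<^sup>2"
proof -
  obtain L :: "real^'n^'n" where L: "\<And>a. (norm (transpose L *v a))\<^sup>2 = a \<bullet> (B *v a)"
    "\<And>\<mu>. gaussian \<mu> B = distr std_gaussian borel (\<lambda>z. \<mu> + L *v z)"
    using gaussian_eq_distr[OF assms(1,2)] by metis
  have eq: "a \<bullet> (L *v z) = (transpose L *v a) \<bullet> z" for z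
    by (metis dot_lmul_matrix transpose_matrix_vector)
  have "measure (gaussian \<mu> B) {y. s \<le> \<bar>a \<bullet> (y - \<mu>)\<bar>} = measure std_gaussian {z. s \<le> \<bar>(transpose L *v a) \<bullet> z\<bar>}"
    unfolding L(2) by (subst measure_distr) (auto simp: vimage_def eq)
  then show ?thesis
    using std_gaussian_tail[OF assms(3), of "transpose L *v a"] by (simp only: L(1))
qed

subsection \<open>Spectral representation of quadratic forms\<close>

text \<open>The transfer function of the functional \<open>x\<close>: its squared modulus weights
  the spectral density in the variance of \<open>x \<bullet> u\<close>.\<close>

definition trig_poly :: "real^('n::{finite,linorder}) \<Rightarrow> real \<Rightarrow> complex" where
  "trig_poly x \<theta> = (\<Sum>j\<in>UNIV. of_real (x $ j) * iexp (real (pos j) * \<theta>))"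

text \<open>The pairing of \<open>x\<close> with the polynomial trend of degree \<open>p\<close>; up
  to the factor \<open>\<i> ^ p\<close>, the derivative of order \<open>p\<close> of
  \<open>trig_poly x\<close> at 0.\<close>

definition moment :: "real^('n::{finite,linorder}) \<Rightarrow> nat \<Rightarrow> real" where
  "moment x p = (\<Sum>j\<in>UNIV. x $ j * real (pos j) ^ p)"

lemma cmod_trig_poly_sq:
  "(cmod (trig_poly x \<theta>))\<^sup>2 = (\<Sum>j\<in>UNIV. \<Sum>l\<in>UNIV. x $ j * x $ l * cos ((real (pos j) - real (pos l)) * \<theta>))"
proof -
  have "Re (trig_poly x \<theta>) = (\<Sum>j\<in>UNIV. x $ j * cos (real (pos j) * \<theta>))"
    and "Im (trig_poly x \<theta>) = (\<Sum>j\<in>UNIV. x $ j * sin (real (pos j) * \<theta>))"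
    by (simp_all add: trig_poly_def Re_exp Im_exp)
  then show ?thesis
    unfolding cmod_power2
    by (simp add: power2_eq_square sum_product sum.distrib[symmetric] left_diff_distrib cos_diff algebra_simps)
qed

lemma continuous_on_trig_poly [continuous_intros]: "continuous_on A (trig_poly x)"
  unfolding trig_poly_def by (intro continuous_intros)

lemma measurable_lebesgue_on_continuous:
  "continuous_on UNIV g \<Longrightarrow> g \<in> borel_measurable (lebesgue_on (A::real set))" for g :: "real \<Rightarrow> 'b::euclidean_space"
  by (intro measurable_restrict_space1 measurable_completion) (simp add: borel_measurable_continuous_onI)

lemma integrable_bounded_mult:
  fixes f g :: "real \<Rightarrow> real"
  assumes "integrable (lebesgue_on A) f" "g \<in> borel_measurable borel"
    "\<And>\<theta>. \<theta> \<in> A \<Longrightarrow> \<bar>g \<theta>\<bar> \<le> K" "A \<in> sets lebesgue"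
  shows "integrable (lebesgue_on A) (\<lambda>\<theta>. g \<theta> * f \<theta>)"
proof (rule Bochner_Integration.integrable_bound)
  show "integrable (lebesgue_on A) (\<lambda>\<theta>. K * f \<theta>)" using assms(1) by simp
  have "g \<in> borel_measurable (lebesgue_on A)"
    using assms(2) by (intro measurable_restrict_space1 measurable_completion) simp
  then show "(\<lambda>\<theta>. g \<theta> * f \<theta>) \<in> borel_measurable (lebesgue_on A)"
    using assms(1) by (intro borel_measurable_times) auto
  show "AE \<theta> in lebesgue_on A. norm (g \<theta> * f \<theta>) \<le> norm (K * f \<theta>)"
    using assms(3,4) by (intro AE_I2) (auto simp: abs_mult intro!: mult_right_mono order.trans[OF assms(3) abs_ge_self])
qed

lemma cmod_trig_poly_le: "cmod (trig_poly x \<theta>) \<le> (\<Sum>j\<in>UNIV. \<bar>x $ j\<bar>)"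
  unfolding trig_poly_def by (rule sum_norm_le) (simp add: norm_mult)

lemma integrable_trig_poly_sq_mult:
  assumes "integrable (lebesgue_on {-pi..pi}) f"
  shows "integrable (lebesgue_on {-pi..pi}) (\<lambda>\<theta>. (cmod (trig_poly x \<theta>))\<^sup>2 * f \<theta>)"
  by (rule integrable_bounded_mult[OF assms, where K = "(\<Sum>j\<in>UNIV. \<bar>x $ j\<bar>)\<^sup>2"])
    (auto intro!: borel_measurable_continuous_onI continuous_intros power_mono cmod_trig_poly_le)

lemma integrable_abs_power_mult:
  assumes "integrable (lebesgue_on {-pi..pi}) f"
  shows "integrable (lebesgue_on {-pi..pi}) (\<lambda>\<theta>. \<bar>\<theta>\<bar> ^ j * f \<theta>)"
  by (rule integrable_bounded_mult[OF assms, where K = "pi ^ j"]) (auto intro!: power_mono)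

lemma Sigma_mat_cos:
  fixes j l :: "'n::{finite,linorder}"
  assumes "integrable (lebesgue_on {-pi..pi}) f"
  shows "Sigma_mat f $ j $ l = (\<integral>\<theta>. cos ((real (pos j) - real (pos l)) * \<theta>) * f \<theta> \<partial>lebesgue_on {-pi..pi})"
proof -
  let ?M = "lebesgue_on {-pi..pi}"
  let ?g = "\<lambda>\<omega>. exp (- \<i> * (of_nat (pos j) - of_nat (pos l)) * of_real \<omega>) * complex_of_real (f \<omega>)"
  have "integrable ?M ?g"
  proof (rule Bochner_Integration.integrable_bound[OF assms])
    have "continuous_on UNIV (\<lambda>\<omega>. exp (- \<i> * (of_nat (pos j) - of_nat (pos l)) * complex_of_real \<omega>))"
      by (intro continuous_intros)
    from measurable_lebesgue_on_continuous[OF this]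
    show "?g \<in> borel_measurable ?M" using assms by measurable
    show "AE \<omega> in ?M. norm (?g \<omega>) \<le> norm (f \<omega>)"
      by (simp add: norm_mult)
  qed
  then have "Sigma_mat f $ j $ l = (\<integral>\<omega>. Re (?g \<omega>) \<partial>?M)"
    unfolding Sigma_mat_def by (simp only: vec_lambda_beta integral_Re)
  then show ?thesis by (simp add: Re_exp)
qed

text \<open>Expanding the squared modulus into cosines reproduces the entries of
  \<open>Sigma_mat f\<close>. Variances become integrals against \<open>f\<close> and can be
  compared through pointwise bounds on \<open>trig_poly\<close>.\<close>

lemma Sigma_mat_quadratic_form:
  assumes "integrable (lebesgue_on {-pi..pi}) f"
  shows "x \<bullet> (Sigma_mat f *v x) = (\<integral>\<theta>. (cmod (trig_poly x \<theta>))\<^sup>2 * f \<theta> \<partial>lebesgue_on {-pi..pi})"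
proof -
  have int: "integrable (lebesgue_on {-pi..pi}) (\<lambda>\<theta>. cos (h * \<theta>) * f \<theta>)" for h
    by (rule integrable_bounded_mult[OF assms, where K = 1]) auto
  have "x \<bullet> (Sigma_mat f *v x) = (\<Sum>j\<in>UNIV. \<Sum>l\<in>UNIV. x $ j * x $ l *
      (\<integral>\<theta>. cos ((real (pos j) - real (pos l)) * \<theta>) * f \<theta> \<partial>lebesgue_on {-pi..pi}))"
    by (simp add: inner_vec_def matrix_vector_mult_def Sigma_mat_cos[OF assms] sum_distrib_left mult_ac)
  also have "\<dots> = (\<integral>\<theta>. (\<Sum>j\<in>UNIV. \<Sum>l\<in>UNIV. x $ j * x $ l * (cos ((real (pos j) - real (pos l)) * \<theta>) * f \<theta>))
      \<partial>lebesgue_on {-pi..pi})"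
    using int by (simp add: integrable_sum)
  also have "\<dots> = (\<integral>\<theta>. (cmod (trig_poly x \<theta>))\<^sup>2 * f \<theta> \<partial>lebesgue_on {-pi..pi})"
    by (simp add: cmod_trig_poly_sq sum_distrib_right mult.assoc)
  finally show ?thesis .
qed

lemma transpose_Sigma_mat: "integrable (lebesgue_on {-pi..pi}) f \<Longrightarrow> transpose (Sigma_mat f) = Sigma_mat f"
proof -
  assume f: "integrable (lebesgue_on {-pi..pi}) f"
  have "cos ((real (pos i) - real (pos j)) * \<theta>) = cos ((real (pos j) - real (pos i)) * \<theta>)" for i j :: 'a and \<theta>
    using cos_minus[of "(real (pos i) - real (pos j)) * \<theta>"] by (simp only: minus_mult_left minus_diff_eq)
  then show ?thesis
    by (simp only: transpose_def vec_eq_iff vec_lambda_beta Sigma_mat_cos[OF f] simp_thms)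
qed

lemma pos_inject: "pos i = pos j \<longleftrightarrow> i = (j :: 'n::{finite,linorder})"
proof
  assume *: "pos i = pos j"
  have "pos a < pos b" if "a < b" for a b :: 'n
    unfolding pos_def using that by (intro psubset_card_mono) (auto simp: less_le_not_le)
  with * show "i = j" by (metis linorder_neqE less_irrefl)
qed simp

lemma integral_cos_period:
  "(\<integral>\<theta>. cos ((real m - real n) * \<theta>) \<partial>lebesgue_on {-pi..pi}) = (if m = n then 2 * pi else 0)"
proof (cases "m = n")
  case False
  define h where "h = real m - real n"
  have h: "h \<noteq> 0" using False by (simp add: h_def)
  \<comment> \<open>\<open>h\<close> is a difference of natural numbers, hence an integer.\<close>
  have "sin (h * pi) = 0"
    by (simp add: h_def left_diff_distrib sin_diff sin_npi cos_npi)
  have "((\<lambda>\<theta>. cos (h * \<theta>)) has_integral (sin (h * pi) / h - sin (h * (-pi)) / h)) {-pi..pi}"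
    using h by (intro fundamental_theorem_of_calculus)
      (auto intro!: derivative_eq_intros simp flip: has_real_derivative_iff_has_vector_derivative)
  then have "integral {-pi..pi} (\<lambda>\<theta>. cos (h * \<theta>)) = 0"
    using \<open>sin (h * pi) = 0\<close> by (simp add: integral_unique)
  moreover have "integrable (lebesgue_on {-pi..pi}) (\<lambda>\<theta>. cos (h * \<theta>))"
    by (intro continuous_imp_integrable_real continuous_intros)
  ultimately have "(\<integral>\<theta>. cos (h * \<theta>) \<partial>lebesgue_on {-pi..pi}) = 0"
    by (simp add: lebesgue_integral_eq_integral)
  then show ?thesis using False by (simp add: h_def)
qed (simp add: measure_restrict_space)

text \<open>Parseval's identity, from the orthogonality of cosines at integer frequencies. It
  evaluates the white-noise component.\<close>

lemma integral_trig_poly_sq: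
  "(\<integral>\<theta>. (cmod (trig_poly x \<theta>))\<^sup>2 \<partial>lebesgue_on {-pi..pi}) = 2 * pi * (norm x)\<^sup>2"
proof -
  have int: "integrable (lebesgue_on {-pi..pi}) (\<lambda>\<theta>. cos (h * \<theta>))" for h
    by (intro continuous_imp_integrable_real continuous_intros)
  have "(\<integral>\<theta>. (cmod (trig_poly x \<theta>))\<^sup>2 \<partial>lebesgue_on {-pi..pi}) =
    (\<Sum>j\<in>UNIV. \<Sum>l\<in>UNIV. x $ j * x $ l * (\<integral>\<theta>. cos ((real (pos j) - real (pos l)) * \<theta>) \<partial>lebesgue_on {-pi..pi}))"
    unfolding cmod_trig_poly_sq using int by (simp add: integrable_sum)
  also have "\<dots> = (\<Sum>j\<in>UNIV. \<Sum>l\<in>UNIV. if j = l then x $ j * x $ l * (2 * pi) else 0)"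
    by (simp add: integral_cos_period pos_inject if_distrib cong: if_cong)
  also have "\<dots> = 2 * pi * (norm x)\<^sup>2"
    by (simp add: power2_norm_eq_inner inner_vec_def sum_distrib_left mult_ac)
  finally show ?thesis .
qed

section \<open>Behaviour of transfer functions near frequency zero\<close>

lemma trig_poly_taylor:
  "\<exists>K\<ge>0. \<forall>\<theta>. cmod (trig_poly x \<theta> - (\<Sum>p\<le>d. (\<i> * of_real \<theta>) ^ p / fact p * of_real (moment x p))) \<le> K * \<bar>\<theta>\<bar> ^ Suc d"
proof (intro exI conjI allI)
  let ?K = "\<Sum>j\<in>UNIV. \<bar>x $ j\<bar> * (real (pos j) ^ Suc d / fact (Suc d))"
  show "0 \<le> ?K" by (intro sum_nonneg) auto
  fix \<theta>
  have "(\<Sum>p\<le>d. (\<i> * of_real \<theta>) ^ p / fact p * of_real (moment x p)) =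
    (\<Sum>j\<in>UNIV. complex_of_real (x $ j) * (\<Sum>p\<le>d. (\<i> * of_real (real (pos j) * \<theta>)) ^ p / fact p))"
    unfolding moment_def of_real_sum sum_distrib_left
    by (subst sum.swap) (simp add: power_mult_distrib mult_ac)
  then have "trig_poly x \<theta> - (\<Sum>p\<le>d. (\<i> * of_real \<theta>) ^ p / fact p * of_real (moment x p)) =
    (\<Sum>j\<in>UNIV. complex_of_real (x $ j) *
      (iexp (real (pos j) * \<theta>) - (\<Sum>p\<le>d. (\<i> * of_real (real (pos j) * \<theta>)) ^ p / fact p)))"
    by (simp only: trig_poly_def right_diff_distrib sum_subtractf)
  also have "cmod \<dots> \<le> (\<Sum>j\<in>UNIV. \<bar>x $ j\<bar> * (\<bar>real (pos j) * \<theta>\<bar> ^ Suc d / fact (Suc d)))"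
    by (intro sum_norm_le) (simp only: norm_mult norm_of_real, intro mult_left_mono iexp_approx1 abs_ge_zero)
  also have "\<dots> = ?K * \<bar>\<theta>\<bar> ^ Suc d"
    unfolding sum_distrib_right by (simp add: abs_mult power_mult_distrib mult_ac)
  finally show "cmod (trig_poly x \<theta> - (\<Sum>p\<le>d. (\<i> * of_real \<theta>) ^ p / fact p * of_real (moment x p))) \<le> ?K * \<bar>\<theta>\<bar> ^ Suc d" .
qed

text \<open>Vanishing moments cancel the whole Taylor polynomial of degree \<open>k - 1\<close>,
  leaving only the remainder; positivity of \<open>k\<close> turns \<open>Suc (k - 1)\<close> into
  \<open>k\<close>.\<close>

lemma trig_poly_upper:
  assumes "\<And>p. p < k \<Longrightarrow> moment x p = 0" "0 < k"
  shows "\<exists>K\<ge>0. \<forall>\<theta>. cmod (trig_poly x \<theta>) \<le> K * \<bar>\<theta>\<bar> ^ k"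
  using trig_poly_taylor[of x "k - 1"] assms by simp

lemma trig_poly_lower:
  assumes "\<And>p. p < d \<Longrightarrow> moment x p = 0" "moment x d \<noteq> 0"
  shows "\<exists>\<kappa>>0. \<exists>\<epsilon>>0. \<forall>\<theta>. \<bar>\<theta>\<bar> \<le> \<epsilon> \<longrightarrow> \<kappa> * \<bar>\<theta>\<bar> ^ d \<le> cmod (trig_poly x \<theta>)"
proof -
  obtain K where K: "K \<ge> 0" and taylor:
    "\<And>\<theta>. cmod (trig_poly x \<theta> - (\<Sum>p\<le>d. (\<i> * of_real \<theta>) ^ p / fact p * of_real (moment x p))) \<le> K * \<bar>\<theta>\<bar> ^ Suc d"
    using trig_poly_taylor[of x d] by metis
  \<comment> \<open>Half the modulus of the leading Taylor coefficient; the other half absorbs the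
    remainder on a short interval.\<close>
  define \<kappa> where "\<kappa> = \<bar>moment x d\<bar> / (2 * fact d)"
  have \<kappa>: "\<kappa> > 0" using assms(2) by (simp add: \<kappa>_def)
  have lead: "(\<Sum>p\<le>d. (\<i> * of_real \<theta>) ^ p / fact p * of_real (moment x p)) =
      (\<i> * of_real \<theta>) ^ d / fact d * of_real (moment x d)" for \<theta>
    using assms(1) by (subst sum.remove[of _ d]) (auto intro!: sum.neutral)
  \<comment> \<open>The radius has \<open>K + 1\<close> in its denominator because \<open>K\<close>
    may be 0.\<close>
  have "\<kappa> * \<bar>\<theta>\<bar> ^ d \<le> cmod (trig_poly x \<theta>)" if "\<bar>\<theta>\<bar> \<le> \<kappa> / (K + 1)" for \<theta>
  proof -
    have "K * \<bar>\<theta>\<bar> \<le> (K + 1) * \<bar>\<theta>\<bar>" by (simp add: mult_right_mono)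
    also have "\<dots> \<le> \<kappa>" using that K by (simp add: field_simps)
    finally have "K * \<bar>\<theta>\<bar> ^ Suc d \<le> \<kappa> * \<bar>\<theta>\<bar> ^ d"
      using mult_right_mono[of "K * \<bar>\<theta>\<bar>" \<kappa> "\<bar>\<theta>\<bar> ^ d"] by (simp add: mult_ac)
    moreover have "cmod ((\<i> * of_real \<theta>) ^ d / fact d * of_real (moment x d)) = 2 * \<kappa> * \<bar>\<theta>\<bar> ^ d"
      by (simp add: \<kappa>_def norm_mult norm_divide norm_power)
    moreover have "cmod ((\<i> * of_real \<theta>) ^ d / fact d * of_real (moment x d)) - cmod (trig_poly x \<theta>) \<le> K * \<bar>\<theta>\<bar> ^ Suc d"
      using taylor[of \<theta>] norm_triangle_ineq2[of "(\<i> * of_real \<theta>) ^ d / fact d * of_real (moment x d)" "trig_poly x \<theta>"]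
      unfolding lead by (simp add: norm_minus_commute)
    ultimately show ?thesis by linarith
  qed
  then show ?thesis using \<kappa> K by (intro exI[of _ \<kappa>] conjI exI[of _ "\<kappa> / (K + 1)"]) auto
qed

subsection \<open>Autoregressive densities with a sharp peak\<close>

lemma cmod_one_minus_iexp_sq:
  "(cmod (1 - of_real \<rho> * iexp \<phi>))\<^sup>2 = (1 - \<rho>)\<^sup>2 + 2 * \<rho> * (1 - cos \<phi>)"
proof -
  have "(cmod (1 - of_real \<rho> * iexp \<phi>))\<^sup>2 = (1 - \<rho> * cos \<phi>)\<^sup>2 + (\<rho> * sin \<phi>)\<^sup>2"
    unfolding cmod_power2 by (simp add: Re_exp Im_exp)
  also have "\<dots> = 1 - 2 * \<rho> * cos \<phi> + \<rho>\<^sup>2 * ((sin \<phi>)\<^sup>2 + (cos \<phi>)\<^sup>2)"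
    by (simp only: power2_eq_square algebra_simps)
  also have "\<dots> = (1 - \<rho>)\<^sup>2 + 2 * \<rho> * (1 - cos \<phi>)"
    by (simp only: sin_cos_squared_add) (simp add: power2_eq_square algebra_simps)
  finally show ?thesis .
qed

lemma cmod_one_minus_iexp_le:
  assumes "0 \<le> \<rho>" "\<rho> \<le> 1"
  shows "cmod (1 - of_real \<rho> * iexp \<phi>) \<le> (1 - \<rho>) + \<bar>\<phi>\<bar>"
proof -
  have "1 - of_real \<rho> * iexp \<phi> = of_real (1 - \<rho>) + of_real \<rho> * (1 - iexp \<phi>)"
    by (simp add: algebra_simps)
  also have "cmod \<dots> \<le> (1 - \<rho>) + \<rho> * cmod (1 - iexp \<phi>)"
    using assms norm_triangle_ineq[of "of_real (1 - \<rho>)" "of_real \<rho> * (1 - iexp \<phi>)"]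
    by (simp only: norm_mult norm_of_real abs_of_nonneg diff_ge_0_iff_ge)
  also have "\<dots> \<le> (1 - \<rho>) + 1 * \<bar>\<phi>\<bar>"
    using assms iexp_approx1[of \<phi> 0] by (intro add_left_mono mult_mono) (auto simp: norm_minus_commute)
  finally show ?thesis by simp
qed

text \<open>The modulus at frequency \<open>\<theta>\<close> of the autoregressive polynomial with
  \<open>a1 = 2 * \<rho> * cos w\<close> and \<open>a2 = - \<rho>\<^sup>2\<close>, kept factored so
  that each root is estimated separately. Its inverse square is an unnormalised spectral
  density.\<close>

definition ar2_gain :: "real \<Rightarrow> real \<Rightarrow> real \<Rightarrow> real" where
  "ar2_gain \<rho> w \<theta> = cmod (1 - of_real \<rho> * iexp (w - \<theta>)) * cmod (1 - of_real \<rho> * iexp (- w - \<theta>))"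

lemma ar2_polynomial_factor:
  "(1 - of_real \<rho> * (iexp w * z)) * (1 - of_real \<rho> * (iexp (- w) * z)) =
    1 - of_real (2 * \<rho> * cos w) * z - of_real (- \<rho>\<^sup>2) * z\<^sup>2"
proof -
  have c: "iexp w + iexp (- w) = of_real (2 * cos w)" "iexp w * iexp (- w) = 1"
    by (simp_all add: complex_eq_iff Re_exp Im_exp flip: exp_add)
  have "(1 - of_real \<rho> * (iexp w * z)) * (1 - of_real \<rho> * (iexp (- w) * z)) =
      1 - of_real \<rho> * (iexp w + iexp (- w)) * z + (of_real \<rho>)\<^sup>2 * (iexp w * iexp (- w)) * z\<^sup>2"
    by (simp add: algebra_simps power2_eq_square)
  then show ?thesis unfolding c by simp
qed

lemma ar2_gain_eq:
  "ar2_gain \<rho> w \<theta> = cmod (1 - of_real (2 * \<rho> * cos w) * exp (- \<i> * of_real \<theta>)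
                     - of_real (- \<rho>\<^sup>2) * exp (- 2 * \<i> * of_real \<theta>))"
proof -
  define z where "z = exp (- \<i> * of_real \<theta>)"
  have z2: "exp (- 2 * \<i> * of_real \<theta>) = z\<^sup>2"
    unfolding z_def exp_double[symmetric] by (simp add: mult.assoc)
  have e: "iexp (v - \<theta>) = iexp v * z" for v
    unfolding z_def exp_add[symmetric] by (simp add: algebra_simps)
  show ?thesis
    unfolding ar2_gain_def z2 e norm_mult[symmetric] z_def[symmetric] ar2_polynomial_factor ..
qed

text \<open>In each linear factor the subtracted term has modulus at most \<open>\<rho>\<close>,
  which is below 1.\<close>

lemma ar2_polynomial_nonzero:
  assumes "0 \<le> \<rho>" "\<rho> < 1" "cmod z \<le> 1"
  shows "1 - of_real (2 * \<rho> * cos w) * z - of_real (- \<rho>\<^sup>2) * z\<^sup>2 \<noteq> 0"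
proof -
  have "1 - of_real \<rho> * (iexp v * z) \<noteq> 0" for v
  proof
    assume "1 - of_real \<rho> * (iexp v * z) = 0"
    then have "cmod (of_real \<rho> * (iexp v * z)) = 1" by (metis eq_iff_diff_eq_0 norm_one)
    then have "\<rho> * cmod z = 1" using assms by (simp add: norm_mult)
    moreover have "\<rho> * cmod z \<le> \<rho> * 1" using assms by (intro mult_left_mono) auto
    ultimately show False using assms by simp
  qed
  then show ?thesis
    unfolding ar2_polynomial_factor[symmetric] by (metis mult_eq_0_iff)
qed

lemma cos_le_away:
  assumes "0 < \<eta>" "\<eta> \<le> \<bar>\<phi>\<bar>" "\<bar>\<phi>\<bar> \<le> 2 * pi - \<eta>" "\<eta> \<le> pi"
  shows "cos \<phi> \<le> cos \<eta>"
proof -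
  have "cos \<bar>\<phi>\<bar> \<le> cos \<eta>"
  proof (cases "\<bar>\<phi>\<bar> \<le> pi")
    case True
    then show ?thesis using assms by (intro cos_monotone_0_pi_le) auto
  next
    case False
    have "cos (2 * pi - \<bar>\<phi>\<bar>) \<le> cos \<eta>"
      using assms False by (intro cos_monotone_0_pi_le) auto
    then show ?thesis by (simp add: cos_diff)
  qed
  then show ?thesis by simp
qed

text \<open>Off the peaks both phases keep distance at least \<open>w / 2\<close> from the multiples
  of \<open>2 * pi\<close>; here \<open>w < pi / 2\<close> enters. The assumption
  \<open>1 / 2 \<le> \<rho>\<close> makes the coefficient \<open>2 * \<rho>\<close> at least 1, so
  the bound is uniform in \<open>\<rho>\<close>.\<close>

lemma ar2_gain_away:
  assumes "1 / 2 \<le> \<rho>" "\<rho> < 1" "0 < w" "w < pi / 2" "\<bar>\<theta>\<bar> \<le> pi" "w / 2 \<le> \<bar>\<bar>\<theta>\<bar> - w\<bar>"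
  shows "1 - cos (w / 2) \<le> ar2_gain \<rho> w \<theta>"
proof -
  have away: "1 - cos (w / 2) \<le> (cmod (1 - of_real \<rho> * iexp \<phi>))\<^sup>2" if "cos \<phi> \<le> cos (w / 2)" for \<phi>
  proof -
    have "1 * (1 - cos (w / 2)) \<le> 2 * \<rho> * (1 - cos \<phi>)"
      using that assms by (intro mult_mono) auto
    then show ?thesis unfolding cmod_one_minus_iexp_sq by (simp add: add_increasing)
  qed
  have "cos (w - \<theta>) \<le> cos (w / 2)" "cos (- w - \<theta>) \<le> cos (w / 2)"
    using assms by (intro cos_le_away; linarith)+
  then have "(1 - cos (w / 2)) * (1 - cos (w / 2)) \<le> (ar2_gain \<rho> w \<theta>)\<^sup>2"
    unfolding ar2_gain_def power_mult_distrib
    by (intro mult_mono away) auto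
  then show ?thesis
    by (metis abs_le_square_iff abs_of_nonneg ar2_gain_def cos_le_one diff_ge_0_iff_ge mult_nonneg_nonneg
        norm_ge_zero power2_eq_square)
qed

text \<open>Close to the peak one factor is at most \<open>2 * (1 - \<rho>)\<close>, and the other
  never exceeds 2.\<close>

lemma ar2_gain_near:
  assumes "0 \<le> \<rho>" "\<rho> < 1" "\<bar>\<theta> - w\<bar> \<le> 1 - \<rho>"
  shows "ar2_gain \<rho> w \<theta> \<le> 4 * (1 - \<rho>)"
proof -
  have "cmod (1 - of_real \<rho> * iexp (w - \<theta>)) \<le> 2 * (1 - \<rho>)"
    using cmod_one_minus_iexp_le[of \<rho> "w - \<theta>"] assms by (smt (verit, best) abs_minus_commute)
  moreover have "cmod (1 - of_real \<rho> * iexp (- w - \<theta>)) \<le> 2"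
    using norm_triangle_ineq4[of 1 "of_real \<rho> * iexp (- w - \<theta>)"] assms by (simp add: norm_mult)
  ultimately show ?thesis
    unfolding ar2_gain_def using assms mult_mono[of "cmod (1 - of_real \<rho> * iexp (w - \<theta>))" "2 * (1 - \<rho>)" _ 2] by simp
qed

lemma ar2_gain_pos:
  assumes "0 \<le> \<rho>" "\<rho> < 1"
  shows "0 < ar2_gain \<rho> w \<theta>"
proof -
  have "0 < (cmod (1 - of_real \<rho> * iexp \<phi>))\<^sup>2" for \<phi>
    unfolding cmod_one_minus_iexp_sq using assms by (intro add_pos_nonneg mult_nonneg_nonneg) auto
  then have "0 < cmod (1 - of_real \<rho> * iexp \<phi>)" for \<phi>
    by (metis norm_ge_zero norm_eq_zero power_zero_numeral less_le)
  then show ?thesis unfolding ar2_gain_def by (intro mult_pos_pos)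
qed

lemma continuous_on_ar2_gain: "continuous_on A (ar2_gain \<rho> w)"
  unfolding ar2_gain_def by (intro continuous_intros)

lemma ar2_gain_minus: "ar2_gain \<rho> w (- \<theta>) = ar2_gain \<rho> w \<theta>"
proof -
  have "cmod (1 - of_real \<rho> * iexp (- \<phi>)) = cmod (1 - of_real \<rho> * iexp \<phi>)" for \<phi>
    by (rule power2_eq_imp_eq) (simp_all only: cmod_one_minus_iexp_sq cos_minus norm_ge_zero)
  from this[of "w - \<theta>"] this[of "- w - \<theta>"] show ?thesis
    by (simp add: ar2_gain_def add.commute mult.commute)
qed

text \<open>As \<open>\<rho>\<close> tends to 1, the total mass \<open>I\<close> of the inverse
  squared gain grows at least like \<open>1 / (8 * (1 - \<rho>))\<close>, whereas off the peaks the
  inverse squared gain stays below \<open>1 / m\<^sup>2\<close>. Normalising therefore pushes the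
  mass off the peaks to 0.\<close>

lemma AR2_concentration:
  assumes "0 < w" "w < pi / 2" "0 < \<delta>"
  obtains f where "f \<in> F_AR2" "\<And>\<theta>. \<theta> \<in> {-pi..pi} \<Longrightarrow> 0 < f \<theta>"
    "(\<integral>\<theta>. indicator {\<theta>. w / 2 \<le> \<bar>\<bar>\<theta>\<bar> - w\<bar>} \<theta> * f \<theta> \<partial>lebesgue_on {-pi..pi}) \<le> \<delta>"
proof -
  let ?M = "lebesgue_on {-pi..pi}"
  define m where "m = 1 - cos (w / 2)"
  have m: "0 < m"
    using cos_monotone_0_pi[of 0 "w / 2"] assms by (simp add: m_def)
  \<comment> \<open>The entry \<open>1 / 2\<close> serves \<open>ar2_gain_away\<close>,
    \<open>w\<close> keeps the peak interval inside \<open>{-pi..pi}\<close>, and the last entry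
    makes \<open>2 * pi / m\<^sup>2 * (8 * (1 - \<rho>))\<close> at most
    \<open>\<delta>\<close>.\<close>
  define \<rho> where "\<rho> = 1 - Min {1 / 2, w, \<delta> * m\<^sup>2 / (16 * pi)}"
  have \<rho>: "1 / 2 \<le> \<rho>" "\<rho> < 1" "1 - \<rho> \<le> w" "1 - \<rho> \<le> \<delta> * m\<^sup>2 / (16 * pi)"
  proof -
    let ?S = "{1 / 2, w, \<delta> * m\<^sup>2 / (16 * pi)}"
    have "0 < Min ?S" using assms m by (subst Min_gr_iff) auto
    moreover have "Min ?S \<le> 1 / 2" "Min ?S \<le> w" "Min ?S \<le> \<delta> * m\<^sup>2 / (16 * pi)"
      by (intro Min_le; simp)+
    ultimately show "1 / 2 \<le> \<rho>" "\<rho> < 1" "1 - \<rho> \<le> w" "1 - \<rho> \<le> \<delta> * m\<^sup>2 / (16 * pi)"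
      unfolding \<rho>_def by linarith+
  qed
  note gain_pos = ar2_gain_pos[of \<rho> w]
  define g where "g \<theta> = 1 / (ar2_gain \<rho> w \<theta>)\<^sup>2" for \<theta>
  have g_pos: "0 < g \<theta>" for \<theta>
    using gain_pos[of \<theta>] \<rho> by (simp add: g_def)
  have cont: "continuous_on UNIV g"
    unfolding g_def using gain_pos \<rho>
    by (intro continuous_intros continuous_on_ar2_gain) (auto simp: less_le)
  have int: "integrable ?M g"
    by (intro continuous_imp_integrable_real continuous_on_subset[OF cont]) auto
  define I where "I = (\<integral>\<theta>. g \<theta> \<partial>?M)"
  have sub: "{w - (1 - \<rho>)..w + (1 - \<rho>)} \<subseteq> {-pi..pi}"
    using \<rho> assms by auto
  \<comment> \<open>Length \<open>2 * (1 - \<rho>)\<close> of the peak interval times the lower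
    bound for \<open>g\<close> on it.\<close>
  have "1 / (8 * (1 - \<rho>)) = (\<integral>\<theta>. indicator {w - (1 - \<rho>)..w + (1 - \<rho>)} \<theta> * (1 / (4 * (1 - \<rho>))\<^sup>2) \<partial>?M)"
  proof -
    have "measure ?M {w - (1 - \<rho>)..w + (1 - \<rho>)} = 2 * (1 - \<rho>)"
      using \<rho> sub by (simp add: measure_restrict_space)
    then have "(\<integral>\<theta>. indicator {w - (1 - \<rho>)..w + (1 - \<rho>)} \<theta> * (1 / (4 * (1 - \<rho>))\<^sup>2) \<partial>?M) =
        2 * (1 - \<rho>) * (1 / (4 * (1 - \<rho>))\<^sup>2)"
      using sub by (simp only: integral_mult_left_zero Bochner_Integration.integral_indicator space_lebesgue_on Int_absorb2)
    also have "2 * e * (1 / (4 * e)\<^sup>2) = 1 / (8 * e)" if "e > 0" for e :: real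
      using that by (simp add: power2_eq_square)
    finally show ?thesis using \<rho> by simp
  qed
  also have "\<dots> \<le> I"
    unfolding I_def
  proof (rule integral_mono)
    show "integrable ?M (\<lambda>\<theta>. indicator {w - (1 - \<rho>)..w + (1 - \<rho>)} \<theta> * (1 / (4 * (1 - \<rho>))\<^sup>2))"
      using sub by (intro integrable_mult_left integrable_real_indicator)
        (simp_all add: sets_restrict_space_iff emeasure_restrict_space Int_absorb2 emeasure_lborel_Icc_eq del: atLeastatMost_subset_iff)
    show "integrable ?M g" by (rule int)
    show "indicator {w - (1 - \<rho>)..w + (1 - \<rho>)} \<theta> * (1 / (4 * (1 - \<rho>))\<^sup>2) \<le> g \<theta>" for \<theta>
    proof (cases "\<theta> \<in> {w - (1 - \<rho>)..w + (1 - \<rho>)}")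
      case True
      then have "ar2_gain \<rho> w \<theta> \<le> 4 * (1 - \<rho>)" using \<rho> by (intro ar2_gain_near) auto
      then show ?thesis
        unfolding g_def using True gain_pos[of \<theta>] \<rho>
        by (simp add: divide_left_mono power_mono)
    qed (use g_pos[of \<theta>] in simp)
  qed
  finally have I: "1 / (8 * (1 - \<rho>)) \<le> I" .
  have I_pos: "0 < I" using I \<rho> by (smt (verit) divide_pos_pos)
  define f where "f = restrict (\<lambda>\<theta>. g \<theta> / I) {-pi..pi}"
  have int_f: "integrable ?M (\<lambda>\<theta>. h \<theta> * f \<theta>) \<longleftrightarrow> integrable ?M (\<lambda>\<theta>. h \<theta> * (g \<theta> / I))" for h
    by (intro Bochner_Integration.integrable_cong) (auto simp: f_def)
  have lint_f: "(\<integral>\<theta>. h \<theta> * f \<theta> \<partial>?M) = (\<integral>\<theta>. h \<theta> * (g \<theta> / I) \<partial>?M)" for h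
    by (intro Bochner_Integration.integral_cong) (auto simp: f_def)
  have "f \<in> F_all"
    unfolding F_all_def
  proof (intro CollectI conjI ballI)
    show "f \<in> extensional {-pi..pi}" by (simp add: f_def)
    show "integrable ?M f" using int_f[of "\<lambda>_. 1"] int by simp
    show "integral\<^sup>L ?M f = 1" using lint_f[of "\<lambda>_. 1"] I_pos by (simp add: I_def)
    fix \<theta> assume \<theta>: "\<theta> \<in> {-pi..pi}"
    then show "0 \<le> f \<theta>" using g_pos[of \<theta>] I_pos by (simp add: f_def)
    show "f (- \<theta>) = f \<theta>" using \<theta> by (simp add: f_def g_def ar2_gain_minus)
  qed
  have "f \<in> F_AR2"
    unfolding F_AR2_def
  proof (intro CollectI conjI exI ballI allI impI)
    show "f \<in> F_all" by fact
    show "1 / I > 0" using I_pos by simp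
    show "1 - of_real (2 * \<rho> * cos w) * z - of_real (- \<rho>\<^sup>2) * z\<^sup>2 \<noteq> 0" if "cmod z \<le> 1" for z
      using \<rho> that by (intro ar2_polynomial_nonzero) auto
    show "f \<theta> = 1 / I / (cmod (1 - of_real (2 * \<rho> * cos w) * exp (- \<i> * of_real \<theta>)
                     - of_real (- \<rho>\<^sup>2) * exp (- 2 * \<i> * of_real \<theta>)))\<^sup>2" if "\<theta> \<in> {-pi..pi}" for \<theta>
      unfolding ar2_gain_eq[symmetric] using that by (simp add: f_def g_def)
  qed
  moreover have "0 < f \<theta>" if "\<theta> \<in> {-pi..pi}" for \<theta>
    using that g_pos[of \<theta>] I_pos by (simp add: f_def)
  moreover have "(\<integral>\<theta>. indicator {\<theta>. w / 2 \<le> \<bar>\<bar>\<theta>\<bar> - w\<bar>} \<theta> * f \<theta> \<partial>?M) \<le> \<delta>"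
  proof -
    have "(\<integral>\<theta>. indicator {\<theta>. w / 2 \<le> \<bar>\<bar>\<theta>\<bar> - w\<bar>} \<theta> * f \<theta> \<partial>?M) \<le> (\<integral>\<theta>. 1 / m\<^sup>2 / I \<partial>?M)"
    proof (rule integral_mono_AE')
      show "integrable ?M (\<lambda>\<theta>. 1 / m\<^sup>2 / I)"
        by (simp add: emeasure_restrict_space)
      show "AE \<theta> in ?M. indicator {\<theta>. w / 2 \<le> \<bar>\<bar>\<theta>\<bar> - w\<bar>} \<theta> * f \<theta> \<le> 1 / m\<^sup>2 / I"
      proof (rule AE_I2)
        fix \<theta> assume "\<theta> \<in> space ?M"
        then have \<theta>: "\<theta> \<in> {-pi..pi}" "\<bar>\<theta>\<bar> \<le> pi" by auto
        show "indicator {\<theta>. w / 2 \<le> \<bar>\<bar>\<theta>\<bar> - w\<bar>} \<theta> * f \<theta> \<le> 1 / m\<^sup>2 / I"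
        proof (cases "w / 2 \<le> \<bar>\<bar>\<theta>\<bar> - w\<bar>")
          case True
          then have "m \<le> ar2_gain \<rho> w \<theta>"
            unfolding m_def using \<rho> assms \<theta> by (intro ar2_gain_away) auto
          then have "g \<theta> \<le> 1 / m\<^sup>2"
            unfolding g_def using m by (intro divide_left_mono power_mono) auto
          then have "g \<theta> / I \<le> 1 / m\<^sup>2 / I" using I_pos by (intro divide_right_mono) auto
          then show ?thesis using True \<theta> by (simp add: f_def)
        qed (use m I_pos in simp)
      qed
      show "AE \<theta> in ?M. 0 \<le> 1 / m\<^sup>2 / I"
        using m I_pos by (intro AE_I2) simp
    qed
    also have "\<dots> = 2 * pi / m\<^sup>2 / I"
      by (simp add: measure_restrict_space)
    also have "\<dots> \<le> 2 * pi / m\<^sup>2 * (8 * (1 - \<rho>))"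
    proof -
      have "1 / I \<le> 8 * (1 - \<rho>)" using I I_pos \<rho> by (simp add: field_simps)
      then have "2 * pi / m\<^sup>2 * (1 / I) \<le> 2 * pi / m\<^sup>2 * (8 * (1 - \<rho>))"
        by (intro mult_left_mono) auto
      then show ?thesis by simp
    qed
    also have "\<dots> \<le> 2 * pi / m\<^sup>2 * (8 * (\<delta> * m\<^sup>2 / (16 * pi)))"
      using \<rho>(4) by (intro mult_left_mono) auto
    also have "\<dots> = \<delta>" using m by (simp add: field_simps)
    finally show ?thesis .
  qed
  ultimately show thesis by (rule that)
qed

text \<open>The density is peaked at a frequency of order \<open>1 / H\<close>; this is where \<open>d < k\<close> enters.\<close>

lemma AR2_moment_ratio:
  fixes k d :: nat
  assumes "d < k" "0 < \<epsilon>" "0 < H"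
  obtains f where "f \<in> F_AR2"
    "0 < (\<integral>\<theta>. \<bar>\<theta>\<bar> ^ (2 * k) * f \<theta> \<partial>lebesgue_on {-pi..pi})"
    "H * (\<integral>\<theta>. \<bar>\<theta>\<bar> ^ (2 * k) * f \<theta> \<partial>lebesgue_on {-pi..pi}) \<le>
      (\<integral>\<theta>. (indicator {-\<epsilon>..\<epsilon>} \<theta> * \<bar>\<theta>\<bar> ^ (2 * d)) * f \<theta> \<partial>lebesgue_on {-pi..pi})"
proof -
  let ?M = "lebesgue_on {-pi..pi}"
  \<comment> \<open>\<open>D\<close> collects the constants below:
    \<open>4 ^ k + pi ^ (2 * k)\<close> from the upper bound, \<open>2 * 4 ^ d\<close> from
    comparing \<open>w ^ (2 * d)\<close> with \<open>(w / 2) ^ (2 * d) / 2\<close>.\<close>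
  define D where "D = 2 * (4::real) ^ d * (4 ^ k + pi ^ (2 * k))"
  have D: "0 < D" by (simp add: D_def add_pos_pos)
  \<comment> \<open>\<open>w \<le> 1\<close> orders the powers of \<open>w\<close>,
    \<open>2 * w \<le> \<epsilon>\<close> puts the peak into the window, and
    \<open>w \<le> 1 / (D * H)\<close> gains the factor \<open>H\<close>.\<close>
  define w where "w = Min {1, \<epsilon> / 2, 1 / (D * H)}"
  have w: "0 < w" "w \<le> 1" "2 * w \<le> \<epsilon>" "w \<le> 1 / (D * H)"
  proof -
    let ?S = "{1, \<epsilon> / 2, 1 / (D * H)}"
    have "0 < Min ?S" using assms D by (subst Min_gr_iff) auto
    moreover have "Min ?S \<le> 1" "Min ?S \<le> \<epsilon> / 2" "Min ?S \<le> 1 / (D * H)"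
      by (intro Min_le; simp)+
    ultimately show "0 < w" "w \<le> 1" "2 * w \<le> \<epsilon>" "w \<le> 1 / (D * H)"
      unfolding w_def by linarith+
  qed
  have "w < pi / 2" using w(2) pi_gt3 by linarith
  let ?away = "{\<theta>. w / 2 \<le> \<bar>\<bar>\<theta>\<bar> - w\<bar>}"
  \<comment> \<open>The bound \<open>1 / 2\<close> leaves half of the mass near the peaks; the bound
    \<open>w ^ (2 * k)\<close> brings the remaining mass down to the order of the moment
    itself.\<close>
  obtain f where f: "f \<in> F_AR2" and f_pos: "\<And>\<theta>. \<theta> \<in> {-pi..pi} \<Longrightarrow> 0 < f \<theta>"
    and away: "(\<integral>\<theta>. indicator ?away \<theta> * f \<theta> \<partial>?M) \<le> min (1 / 2) (w ^ (2 * k))"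
    using AR2_concentration[OF w(1) \<open>w < pi / 2\<close>, of "min (1 / 2) (w ^ (2 * k))"] w(1) by auto
  have f_int: "integrable ?M f" and f_1: "(\<integral>\<theta>. f \<theta> \<partial>?M) = 1"
    using f by (auto simp: F_AR2_def F_all_def)
  have int_ind: "integrable ?M (\<lambda>\<theta>. indicator A \<theta> * f \<theta>)" if "A \<in> sets borel" for A
    using that by (intro integrable_bounded_mult[OF f_int, where K = 1]) (auto split: split_indicator)
  have away_borel: "?away \<in> sets borel" by measurable
  note int_pow = integrable_abs_power_mult[OF f_int]
  let ?\<tau> = "\<integral>\<theta>. \<bar>\<theta>\<bar> ^ (2 * k) * f \<theta> \<partial>?M"
  let ?\<nu> = "\<integral>\<theta>. (indicator {-\<epsilon>..\<epsilon>} \<theta> * \<bar>\<theta>\<bar> ^ (2 * d)) * f \<theta> \<partial>?M"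
  have upper: "?\<tau> \<le> (4 ^ k + pi ^ (2 * k)) * w ^ (2 * k)"
  proof -
    have "?\<tau> \<le> (\<integral>\<theta>. (2 * w) ^ (2 * k) * f \<theta> + pi ^ (2 * k) * (indicator ?away \<theta> * f \<theta>) \<partial>?M)"
    proof (rule integral_mono)
      fix \<theta> assume "\<theta> \<in> space ?M"
      then have \<theta>: "\<theta> \<in> {-pi..pi}" "\<bar>\<theta>\<bar> \<le> pi" by auto
      note p = less_imp_le[OF f_pos[OF \<theta>(1)]]
      show "\<bar>\<theta>\<bar> ^ (2 * k) * f \<theta> \<le> (2 * w) ^ (2 * k) * f \<theta> + pi ^ (2 * k) * (indicator ?away \<theta> * f \<theta>)"
      proof (cases "\<theta> \<in> ?away")
        case True
        have "\<bar>\<theta>\<bar> ^ (2 * k) * f \<theta> \<le> pi ^ (2 * k) * f \<theta>"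
          using \<theta> p by (intro mult_right_mono power_mono) auto
        moreover have "0 \<le> (2 * w) ^ (2 * k) * f \<theta>" using p w by simp
        ultimately show ?thesis using True by simp
      next
        case False
        then have "\<bar>\<bar>\<theta>\<bar> - w\<bar> < w / 2" by simp
        then have "\<bar>\<theta>\<bar> \<le> 2 * w" using w(1) by linarith
        then have "\<bar>\<theta>\<bar> ^ (2 * k) * f \<theta> \<le> (2 * w) ^ (2 * k) * f \<theta>"
          using p by (intro mult_right_mono power_mono) auto
        then show ?thesis using False by simp
      qed
    qed (use int_pow f_int int_ind[OF away_borel] in auto)
    also have "\<dots> = (2 * w) ^ (2 * k) + pi ^ (2 * k) * (\<integral>\<theta>. indicator ?away \<theta> * f \<theta> \<partial>?M)"
      using f_int int_ind[OF away_borel] f_1 by simp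
    also have "\<dots> \<le> (2 * w) ^ (2 * k) + pi ^ (2 * k) * w ^ (2 * k)"
      using away by (intro add_left_mono mult_left_mono) auto
    also have "(2 * w) ^ (2 * k) = 4 ^ k * w ^ (2 * k)"
      unfolding power_mult by (simp add: power_mult_distrib)
    finally show ?thesis by (simp add: algebra_simps)
  qed
  \<comment> \<open>General in window and exponent because it is used twice: with
    \<open>{-\<epsilon>..\<epsilon>}\<close> and the given \<open>d\<close> for the ratio, with
    \<open>UNIV\<close> and \<open>k\<close> for positivity.\<close>
  have lower: "(w / 2) ^ (2 * d) / 2 \<le> (\<integral>\<theta>. (indicator A \<theta> * \<bar>\<theta>\<bar> ^ (2 * d)) * f \<theta> \<partial>?M)"
    if "A \<in> sets borel" "{-\<epsilon>..\<epsilon>} \<subseteq> A" for A d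
  proof -
    have "(w / 2) ^ (2 * d) * (1 / 2) \<le> (w / 2) ^ (2 * d) * (1 - (\<integral>\<theta>. indicator ?away \<theta> * f \<theta> \<partial>?M))"
      using away w(1) by (intro mult_left_mono) auto
    also have "\<dots> = (\<integral>\<theta>. (w / 2) ^ (2 * d) * (f \<theta> - indicator ?away \<theta> * f \<theta>) \<partial>?M)"
      using f_int int_ind[OF away_borel] f_1 by simp
    also have "\<dots> \<le> (\<integral>\<theta>. (indicator A \<theta> * \<bar>\<theta>\<bar> ^ (2 * d)) * f \<theta> \<partial>?M)"
    proof (rule integral_mono)
      have "integrable ?M (\<lambda>\<theta>. \<bar>\<theta>\<bar> ^ (2 * d) * (indicator A \<theta> * f \<theta>))"
        by (rule integrable_bounded_mult[OF int_ind[OF that(1)], where K = "pi ^ (2 * d)"])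
          (auto intro!: power_mono)
      then show "integrable ?M (\<lambda>\<theta>. (indicator A \<theta> * \<bar>\<theta>\<bar> ^ (2 * d)) * f \<theta>)"
        by (simp add: mult_ac)
      fix \<theta> assume "\<theta> \<in> space ?M"
      then have \<theta>: "\<theta> \<in> {-pi..pi}" by auto
      note p = less_imp_le[OF f_pos[OF \<theta>]]
      show "(w / 2) ^ (2 * d) * (f \<theta> - indicator ?away \<theta> * f \<theta>) \<le> (indicator A \<theta> * \<bar>\<theta>\<bar> ^ (2 * d)) * f \<theta>"
      proof (cases "\<theta> \<in> ?away")
        case False
        then have "\<bar>\<bar>\<theta>\<bar> - w\<bar> < w / 2" by simp
        then have "w / 2 \<le> \<bar>\<theta>\<bar>" "\<bar>\<theta>\<bar> \<le> 2 * w" using w(1) by linarith+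
        then have "(w / 2) ^ (2 * d) * f \<theta> \<le> \<bar>\<theta>\<bar> ^ (2 * d) * f \<theta>" "\<theta> \<in> {-\<epsilon>..\<epsilon>}"
          using p w by (auto intro!: mult_right_mono power_mono)
        then show ?thesis using False that(2) by (auto simp: indicator_def)
      qed (use p in simp)
    qed (use f_int int_ind[OF away_borel] in auto)
    finally show ?thesis by simp
  qed
  have "H * ?\<tau> \<le> H * ((4 ^ k + pi ^ (2 * k)) * w ^ (2 * k))"
    using upper assms by (intro mult_left_mono) auto
  \<comment> \<open>\<open>d < k\<close> leaves a spare factor \<open>w\<close>, which absorbs
    \<open>H * D\<close>.\<close>
  also have "\<dots> \<le> H * ((4 ^ k + pi ^ (2 * k)) * (w ^ (2 * d) * w))"
  proof -
    have "w ^ (2 * k) \<le> w ^ Suc (2 * d)" using assms w by (intro power_decreasing) auto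
    then show ?thesis using assms by (intro mult_left_mono) (auto simp: mult.commute add_nonneg_nonneg)
  qed
  also have "\<dots> = (w / 2) ^ (2 * d) / 2 * (H * D * w)"
  proof -
    have eq: "w ^ (2 * d) = (w / 2) ^ (2 * d) * 4 ^ d"
      unfolding power_mult by (simp add: power_divide)
    show ?thesis unfolding D_def eq by (simp add: algebra_simps)
  qed
  also have "\<dots> \<le> (w / 2) ^ (2 * d) / 2 * 1"
    using w D assms by (intro mult_left_mono) (auto simp: field_simps)
  also have "\<dots> \<le> ?\<nu>" using lower[of "{-\<epsilon>..\<epsilon>}" d] by simp
  finally have "H * ?\<tau> \<le> ?\<nu>" .
  moreover have "0 < ?\<tau>"
  proof (rule less_le_trans)
    show "0 < (w / 2) ^ (2 * k) / 2" using w(1) by simp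
    show "(w / 2) ^ (2 * k) / 2 \<le> ?\<tau>" using lower[of UNIV k] by simp
  qed
  ultimately show thesis using f by (intro that)
qed

text \<open>By Parseval the constant density \<open>1 / (2 * pi)\<close> has identity covariance. A
  positive \<open>c2\<close> thus keeps variances away from 0 even in directions that the peaked
  part hardly reaches.\<close>

lemma Sigma_mat_white_noise_mixture:
  assumes "f \<in> F_AR2" "g = restrict (\<lambda>\<theta>. c1 * f \<theta> + c2 / (2 * pi)) {-pi..pi}"
  shows "x \<bullet> (Sigma_mat g *v x) =
    c1 * (\<integral>\<theta>. (cmod (trig_poly x \<theta>))\<^sup>2 * f \<theta> \<partial>lebesgue_on {-pi..pi}) + c2 * (norm x)\<^sup>2"
proof -
  let ?M = "lebesgue_on {-pi..pi}"
  have f_int: "integrable ?M f" using assms(1) by (auto simp: F_AR2_def F_all_def)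
  have "integrable ?M (\<lambda>\<theta>. c1 * f \<theta> + c2 / (2 * pi))"
    using f_int by (simp add: emeasure_restrict_space)
  then have g_int: "integrable ?M g"
    by (rule Bochner_Integration.integrable_cong[THEN iffD1, rotated -1]) (auto simp: assms(2))
  note int1 = integrable_trig_poly_sq_mult[OF f_int]
  have int2: "integrable ?M (\<lambda>\<theta>. (cmod (trig_poly x \<theta>))\<^sup>2)"
    by (intro continuous_imp_integrable_real continuous_intros)
  have "x \<bullet> (Sigma_mat g *v x) = (\<integral>\<theta>. (cmod (trig_poly x \<theta>))\<^sup>2 * g \<theta> \<partial>?M)"
    by (rule Sigma_mat_quadratic_form[OF g_int])
  also have "\<dots> = (\<integral>\<theta>. c1 * ((cmod (trig_poly x \<theta>))\<^sup>2 * f \<theta>) + (c2 / (2 * pi)) * (cmod (trig_poly x \<theta>))\<^sup>2 \<partial>?M)"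
    by (intro Bochner_Integration.integral_cong) (auto simp: assms(2) algebra_simps)
  also have "\<dots> = c1 * (\<integral>\<theta>. (cmod (trig_poly x \<theta>))\<^sup>2 * f \<theta> \<partial>?M) + (c2 / (2 * pi)) * (2 * pi * (norm x)\<^sup>2)"
    using int1[of x] int2 by (subst Bochner_Integration.integral_add) (simp_all add: integral_trig_poly_sq)
  finally show ?thesis by simp
qed

text \<open>The peaked part gives directions in \<open>S\<close> a variance of order
  \<open>\<tau>\<close>, its moment of order \<open>2 * k\<close>, while that of \<open>a\<close>
  follows the much larger moment of order \<open>2 * d\<close> near 0. White noise of weight matched
  to \<open>\<tau>\<close> keeps the variance along \<open>w\<close> comparable with the bound on
  \<open>S\<close>. Since \<open>\<kappa>\<close> is fixed before \<open>H\<close>, a later choice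
  of \<open>H\<close> may depend on it.\<close>

lemma spectral_separation:
  fixes S :: "(real^('n::{finite,linorder})) set" and a w :: "real^('n::{finite,linorder})"
  assumes "finite S" "\<And>x p. x \<in> S \<Longrightarrow> p < k \<Longrightarrow> moment x p = 0" "w \<noteq> 0"
    and "\<And>p. p < d \<Longrightarrow> moment a p = 0" "moment a d \<noteq> 0" "d < k"
  obtains \<kappa> where "0 < \<kappa>" "\<And>H. \<exists>f\<in>F_AR2_ext. \<exists>t>0. (\<forall>x\<in>S. x \<bullet> (Sigma_mat f *v x) \<le> t) \<and>
    \<kappa> * t \<le> w \<bullet> (Sigma_mat f *v w) \<and> H * t \<le> a \<bullet> (Sigma_mat f *v a)"
proof -
  let ?M = "lebesgue_on {-pi..pi}"
  have "\<exists>K\<ge>0. \<forall>\<theta>. cmod (trig_poly x \<theta>) \<le> K * \<bar>\<theta>\<bar> ^ k" if "x \<in> S" for x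
    using assms that by (intro trig_poly_upper) auto
  then obtain K where K: "\<And>x. x \<in> S \<Longrightarrow> 0 \<le> K x" "\<And>x \<theta>. x \<in> S \<Longrightarrow> cmod (trig_poly x \<theta>) \<le> K x * \<bar>\<theta>\<bar> ^ k"
    by metis
  obtain \<kappa>a \<epsilon> where \<kappa>a: "0 < \<kappa>a" "0 < \<epsilon>" "\<And>\<theta>. \<bar>\<theta>\<bar> \<le> \<epsilon> \<Longrightarrow> \<kappa>a * \<bar>\<theta>\<bar> ^ d \<le> cmod (trig_poly a \<theta>)"
    using trig_poly_lower[OF assms(4,5)] by metis
  \<comment> \<open>One constant for all directions; the leading 1 keeps it positive when
    \<open>S\<close> is empty.\<close>
  define L where "L = 1 + (\<Sum>x\<in>S. (K x)\<^sup>2 + (norm x)\<^sup>2)"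
  have L: "1 \<le> L" "\<And>x. x \<in> S \<Longrightarrow> (K x)\<^sup>2 + (norm x)\<^sup>2 \<le> L"
    unfolding L_def using assms(1) sum_nonneg[of S "\<lambda>x. (K x)\<^sup>2 + (norm x)\<^sup>2"]
    by (auto intro!: add_increasing[of 1] member_le_sum[of _ S "\<lambda>x. (K x)\<^sup>2 + (norm x)\<^sup>2"])
  show thesis
  proof
    show "0 < (norm w)\<^sup>2 / L" using L(1) assms(3) by simp
    fix H0 :: real
    \<comment> \<open>\<open>AR2_moment_ratio\<close> wants a positive factor, while
      \<open>H0\<close> is an arbitrary real.\<close>
    define H where "H = \<bar>H0\<bar> + 1"
    obtain f where f: "f \<in> F_AR2" and \<tau>_pos: "0 < (\<integral>\<theta>. \<bar>\<theta>\<bar> ^ (2 * k) * f \<theta> \<partial>?M)"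
      and ratio: "H * L / \<kappa>a\<^sup>2 * (\<integral>\<theta>. \<bar>\<theta>\<bar> ^ (2 * k) * f \<theta> \<partial>?M) \<le>
        (\<integral>\<theta>. (indicator {-\<epsilon>..\<epsilon>} \<theta> * \<bar>\<theta>\<bar> ^ (2 * d)) * f \<theta> \<partial>?M)"
      using AR2_moment_ratio[OF assms(6) \<kappa>a(2), of "H * L / \<kappa>a\<^sup>2"] L(1) \<kappa>a(1) by (auto simp: H_def)
    define \<tau> where "\<tau> = (\<integral>\<theta>. \<bar>\<theta>\<bar> ^ (2 * k) * f \<theta> \<partial>?M)"
    have \<tau>: "0 < \<tau>" using \<tau>_pos by (simp add: \<tau>_def)
    have f_int: "integrable ?M f" and f_nonneg: "\<And>\<theta>. \<theta> \<in> {-pi..pi} \<Longrightarrow> 0 \<le> f \<theta>"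
      using f by (auto simp: F_AR2_def F_all_def)
    \<comment> \<open>Weights in the ratio 1 to \<open>\<tau>\<close>: by
      \<open>c1 * \<tau> = c2\<close>, peaked part and white noise contribute to \<open>S\<close> at
      the same order \<open>c2\<close>.\<close>
    define c1 c2 where "c1 = 1 / (1 + \<tau>)" and "c2 = \<tau> / (1 + \<tau>)"
    have c: "0 < c1" "0 < c2" "c1 + c2 = 1" "c1 * \<tau> = c2"
      using \<tau> by (auto simp: c1_def c2_def field_simps)
    define g where "g = restrict (\<lambda>\<theta>. c1 * f \<theta> + c2 / (2 * pi)) {-pi..pi}"
    have "g \<in> F_AR2_ext"
      unfolding F_AR2_ext_def g_def using f c less_imp_le by blast
    note int = integrable_trig_poly_sq_mult[OF f_int]
    note int_pow = integrable_abs_power_mult[OF f_int]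
    note quad = Sigma_mat_white_noise_mixture[OF f g_def]
    have 1: "x \<bullet> (Sigma_mat g *v x) \<le> c2 * L" if "x \<in> S" for x
    proof -
      have "(\<integral>\<theta>. (cmod (trig_poly x \<theta>))\<^sup>2 * f \<theta> \<partial>?M) \<le> (\<integral>\<theta>. (K x)\<^sup>2 * (\<bar>\<theta>\<bar> ^ (2 * k) * f \<theta>) \<partial>?M)"
      proof (rule integral_mono)
        fix \<theta> assume "\<theta> \<in> space ?M"
        then have "0 \<le> f \<theta>" using f_nonneg by auto
        moreover have "(cmod (trig_poly x \<theta>))\<^sup>2 \<le> (K x * \<bar>\<theta>\<bar> ^ k)\<^sup>2"
          using K(2)[OF that] by (intro power_mono) auto
        ultimately show "(cmod (trig_poly x \<theta>))\<^sup>2 * f \<theta> \<le> (K x)\<^sup>2 * (\<bar>\<theta>\<bar> ^ (2 * k) * f \<theta>)"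
          by (simp only: power_mult_distrib mult.assoc[symmetric] mult_right_mono power_mult[symmetric] mult.commute[of k 2])
      qed (use int int_pow in auto)
      also have "\<dots> = (K x)\<^sup>2 * \<tau>" by (simp add: \<tau>_def)
      finally have "x \<bullet> (Sigma_mat g *v x) \<le> c1 * ((K x)\<^sup>2 * \<tau>) + c2 * (norm x)\<^sup>2"
        unfolding quad using c by (intro add_right_mono mult_left_mono) auto
      also have "\<dots> = c2 * ((K x)\<^sup>2 + (norm x)\<^sup>2)"
        unfolding c(4)[symmetric] by (simp add: algebra_simps)
      also have "\<dots> \<le> c2 * L" using L(2)[OF that] c by (intro mult_left_mono) auto
      finally show ?thesis .
    qed
    have nonneg: "0 \<le> (\<integral>\<theta>. (cmod (trig_poly x \<theta>))\<^sup>2 * f \<theta> \<partial>?M)" for x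
      by (intro Bochner_Integration.integral_nonneg_AE AE_I2) (auto intro!: mult_nonneg_nonneg f_nonneg)
    have 2: "(norm w)\<^sup>2 / L * (c2 * L) \<le> w \<bullet> (Sigma_mat g *v w)"
      unfolding quad using nonneg[of w] c L(1) by simp
    have 3: "H0 * (c2 * L) \<le> a \<bullet> (Sigma_mat g *v a)"
    proof -
      have "H0 * (c2 * L) \<le> H * (c2 * L)"
        using c L(1) by (intro mult_right_mono) (auto simp: H_def)
      also have "\<dots> = c1 * (\<kappa>a\<^sup>2 * (H * L / \<kappa>a\<^sup>2 * \<tau>))"
        unfolding c(4)[symmetric] using \<kappa>a(1) by simp
      also have "\<dots> \<le> c1 * (\<kappa>a\<^sup>2 * (\<integral>\<theta>. (indicator {-\<epsilon>..\<epsilon>} \<theta> * \<bar>\<theta>\<bar> ^ (2 * d)) * f \<theta> \<partial>?M))"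
        using ratio c by (intro mult_left_mono) (auto simp: \<tau>_def)
      also have "\<dots> = c1 * (\<integral>\<theta>. \<kappa>a\<^sup>2 * ((indicator {-\<epsilon>..\<epsilon>} \<theta> * \<bar>\<theta>\<bar> ^ (2 * d)) * f \<theta>) \<partial>?M)"
        by simp
      \<comment> \<open>Inside the window the lower Taylor bound applies; outside it the left
        integrand is 0.\<close>
      also have "\<dots> \<le> c1 * (\<integral>\<theta>. (cmod (trig_poly a \<theta>))\<^sup>2 * f \<theta> \<partial>?M)"
      proof (intro mult_left_mono integral_mono_AE' AE_I2)
        fix \<theta> assume "\<theta> \<in> space ?M"
        then have p: "0 \<le> f \<theta>" using f_nonneg by auto
        show "0 \<le> (cmod (trig_poly a \<theta>))\<^sup>2 * f \<theta>" using p by simp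
        show "\<kappa>a\<^sup>2 * ((indicator {-\<epsilon>..\<epsilon>} \<theta> * \<bar>\<theta>\<bar> ^ (2 * d)) * f \<theta>) \<le> (cmod (trig_poly a \<theta>))\<^sup>2 * f \<theta>"
        proof (cases "\<bar>\<theta>\<bar> \<le> \<epsilon>")
          case True
          have "(\<kappa>a * \<bar>\<theta>\<bar> ^ d)\<^sup>2 \<le> (cmod (trig_poly a \<theta>))\<^sup>2"
            using \<kappa>a(1) \<kappa>a(3)[OF True] by (intro power_mono) auto
          then have "(\<kappa>a * \<bar>\<theta>\<bar> ^ d)\<^sup>2 * f \<theta> \<le> (cmod (trig_poly a \<theta>))\<^sup>2 * f \<theta>"
            using p by (rule mult_right_mono)
          moreover have "indicator {-\<epsilon>..\<epsilon>} \<theta> = (1::real)" using True by (simp add: abs_le_iff)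
          ultimately show ?thesis
            by (simp only: power_mult_distrib mult.assoc power_mult[symmetric] mult.commute[of d 2] mult_1)
        next
          case False
          then have "indicator {-\<epsilon>..\<epsilon>} \<theta> = (0::real)" by (auto simp: abs_le_iff)
          then show ?thesis using p by (simp only: mult_zero_left mult_zero_right) simp
        qed
      qed (use int c in auto)
      also have "\<dots> \<le> a \<bullet> (Sigma_mat g *v a)"
        unfolding quad using c by simp
      finally show ?thesis .
    qed
    show "\<exists>f\<in>F_AR2_ext. \<exists>t>0. (\<forall>x\<in>S. x \<bullet> (Sigma_mat f *v x) \<le> t) \<and>
      (norm w)\<^sup>2 / L * t \<le> w \<bullet> (Sigma_mat f *v w) \<and> H0 * t \<le> a \<bullet> (Sigma_mat f *v a)"
      using 1 2 3 \<open>g \<in> F_AR2_ext\<close> c L(1) by (intro bexI[of _ g] exI[of _ "c2 * L"]) auto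
  qed
qed

subsection \<open>Least squares\<close>

lemma matrix_inv:
  fixes M :: "real^'l^'l"
  assumes "invertible M"
  shows "M ** matrix_inv M = mat 1" "matrix_inv M ** M = mat 1"
  using someI_ex[OF assms[unfolded invertible_def]] by (auto simp: matrix_inv_def)

lemma matrix_inv_unique:
  fixes M :: "real^'l^'l"
  assumes "M ** B = mat 1"
  shows "matrix_inv M = B"
proof -
  have "invertible M" using assms by (auto simp: invertible_right_inverse)
  then have "matrix_inv M ** (M ** B) = B"
    by (simp add: matrix_mul_assoc matrix_inv)
  then show ?thesis by (simp add: assms)
qed

lemma matrix_inv_mult_vector:
  fixes M :: "real^'l^'l"
  assumes "invertible M"
  shows "M *v (matrix_inv M *v x) = x" "matrix_inv M *v (M *v x) = x"
  using matrix_inv[OF assms] by (simp_all add: matrix_vector_mul_assoc)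

lemma invertible_scaleR:
  fixes M :: "real^'l^'l"
  assumes "invertible M" "s \<noteq> 0"
  shows "invertible (s *\<^sub>R M)" "matrix_inv (s *\<^sub>R M) = (1 / s) *\<^sub>R matrix_inv M"
proof -
  have "(s *\<^sub>R M) ** ((1 / s) *\<^sub>R matrix_inv M) = mat 1"
    using assms by (simp add: scalar_matrix_assoc[symmetric] matrix_scalar_ac matrix_inv)
  then show "invertible (s *\<^sub>R M)" "matrix_inv (s *\<^sub>R M) = (1 / s) *\<^sub>R matrix_inv M"
    by (auto simp: invertible_right_inverse intro: matrix_inv_unique)
qed

lemma inner_transpose_mult: "x \<bullet> (transpose M *v y) = (M *v x) \<bullet> y" for M :: "real^'l^'n"
  by (metis dot_lmul_matrix inner_commute transpose_matrix_vector)

text \<open>Symmetry is included because the estimator conditions require it of the covariance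
  estimator.\<close>

definition pos_def :: "real^'l^'l \<Rightarrow> bool" where
  "pos_def M \<longleftrightarrow> transpose M = M \<and> (\<forall>x. x \<noteq> 0 \<longrightarrow> 0 < x \<bullet> (M *v x))"

lemma inj_mult_nonzero: "inj ((*v) C) \<Longrightarrow> x \<noteq> 0 \<Longrightarrow> C *v x \<noteq> 0" for C :: "real^'l^'n"
  by (metis injD matrix_vector_mult_0_right)

lemma pos_def_gram: "inj ((*v) Z) \<Longrightarrow> pos_def (transpose Z ** Z)" for Z :: "real^'l^'n"
  using inj_mult_nonzero[of Z]
  by (simp add: pos_def_def matrix_transpose_mul transpose_transpose inner_transpose_mult
      del: transpose_matrix_vector flip: matrix_vector_mul_assoc)

lemma pos_def_congruence:
  "pos_def M \<Longrightarrow> inj ((*v) C) \<Longrightarrow> pos_def (transpose C ** M ** C)" for C :: "real^'l^'n"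
  using inj_mult_nonzero[of C]
  by (simp add: pos_def_def matrix_transpose_mul transpose_transpose inner_transpose_mult matrix_mul_assoc
      del: transpose_matrix_vector flip: matrix_vector_mul_assoc)

lemma pos_def_invertible: "pos_def M \<Longrightarrow> invertible M"
  unfolding invertible_left_inverse matrix_left_invertible_ker pos_def_def
  by (metis inner_zero_right less_irrefl)

lemma pos_def_inv:
  assumes "pos_def M"
  shows "pos_def (matrix_inv M)"
proof -
  note inv = pos_def_invertible[OF assms]
  have "M ** transpose (matrix_inv M) = mat 1"
    using assms matrix_inv(2)[OF inv] by (metis matrix_transpose_mul pos_def_def transpose_mat)
  then have "transpose (matrix_inv M) = matrix_inv M"
    by (metis matrix_inv_unique)
  moreover have "0 < x \<bullet> (matrix_inv M *v x)" if "x \<noteq> 0" for x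
  proof -
    let ?z = "matrix_inv M *v x"
    have x: "x = M *v ?z" using inv by (simp add: matrix_inv_mult_vector)
    then have "?z \<noteq> 0" using that by (metis matrix_vector_mult_0_right)
    then have "0 < ?z \<bullet> (M *v ?z)" using assms by (simp add: pos_def_def)
    then show ?thesis using x by (simp add: inner_commute)
  qed
  ultimately show ?thesis by (simp add: pos_def_def)
qed

lemma quadratic_form_le:
  fixes M :: "real^'l^'l"
  obtains K where "0 \<le> K" "\<And>x. x \<bullet> (M *v x) \<le> K * (norm x)\<^sup>2"
proof
  show "0 \<le> onorm ((*v) M)" by (intro onorm_pos_le) simp
  fix x
  have "x \<bullet> (M *v x) \<le> norm x * norm (M *v x)" by (rule norm_cauchy_schwarz)
  also have "\<dots> \<le> norm x * (onorm ((*v) M) * norm x)"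
    by (intro mult_left_mono onorm) auto
  finally show "x \<bullet> (M *v x) \<le> onorm ((*v) M) * (norm x)\<^sup>2"
    by (simp add: power2_eq_square mult_ac)
qed

text \<open>The constant is the minimum over the unit sphere, attained by compactness; homogeneity
  does the rest.\<close>

lemma pos_def_ge:
  fixes M :: "real^'l^'l"
  assumes "pos_def M"
  obtains \<kappa> where "0 < \<kappa>" "\<And>x. \<kappa> * (norm x)\<^sup>2 \<le> x \<bullet> (M *v x)"
proof -
  have "sphere 0 1 \<noteq> ({} :: (real^'l) set)"
    using norm_axis_1 by (metis empty_iff mem_sphere_0)
  moreover have "continuous_on (sphere 0 1) (\<lambda>x. x \<bullet> (M *v x))"
    by (intro continuous_intros)
  ultimately have "\<exists>u\<in>sphere 0 1. \<forall>x\<in>sphere 0 1. u \<bullet> (M *v u) \<le> x \<bullet> (M *v x)"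
    by (intro continuous_attains_inf) auto
  then obtain u :: "real^'l" where u: "u \<in> sphere 0 1" "\<And>x. x \<in> sphere 0 1 \<Longrightarrow> u \<bullet> (M *v u) \<le> x \<bullet> (M *v x)"
    by blast
  show thesis
  proof
    have "u \<noteq> 0" using u(1) by auto
    then show "0 < u \<bullet> (M *v u)" using assms by (simp add: pos_def_def)
    fix x
    show "(u \<bullet> (M *v u)) * (norm x)\<^sup>2 \<le> x \<bullet> (M *v x)"
    proof (cases "x = 0")
      case False
      then have "u \<bullet> (M *v u) \<le> (x /\<^sub>R norm x) \<bullet> (M *v (x /\<^sub>R norm x))"
        by (intro u(2)) simp
      also have "\<dots> = (x \<bullet> (M *v x)) / (norm x)\<^sup>2"
        by (simp add: matrix_vector_mult_scaleR power2_eq_square field_simps)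
      finally show ?thesis using False by (simp add: field_simps)
    qed simp
  qed
qed

section \<open>Column spaces, projections and residuals\<close>

lemma col_space_eq_range: "col_space Z = range ((*v) Z)" for Z :: "real^'l^'n"
proof
  show "range ((*v) Z) \<subseteq> col_space Z"
    by (auto simp: col_space_def matrix_vector_mult_in_columnspace)
  have "columns Z \<subseteq> range ((*v) Z)"
    by (auto simp: columns_def) (metis matrix_vector_mul_component matrix_vector_mult_basis rangeI)
  then show "col_space Z \<subseteq> range ((*v) Z)"
    unfolding col_space_def
    by (intro span_minimal linear_subspace_image matrix_vector_mul_linear subspace_UNIV)
qed

lemma linear_beta_hat: "linear (\<lambda>y. beta_hat Z (D *v y))" for D :: "real^'p^'n"
  unfolding beta_hat_def matrix_vector_mul_assoc by (rule matrix_vector_mul_linear)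

lemma beta_hat_fitted:
  assumes "inj ((*v) Z)"
  shows "beta_hat Z (Z *v \<eta>) = \<eta>"
  using matrix_inv_mult_vector(2)[OF pos_def_invertible[OF pos_def_gram[OF assms]]]
  by (simp add: beta_hat_def matrix_vector_mul_assoc)

text \<open>The normal equations, tested against \<open>\<eta>\<close>.\<close>

lemma beta_hat_residual_orthogonal:
  assumes "inj ((*v) Z)"
  shows "(Z *v \<eta>) \<bullet> (y - Z *v beta_hat Z y) = 0"
proof -
  have "transpose Z *v (Z *v beta_hat Z y) = transpose Z *v y"
    using matrix_inv_mult_vector(1)[OF pos_def_invertible[OF pos_def_gram[OF assms]], of "transpose Z *v y"]
    by (simp only: beta_hat_def matrix_vector_mul_assoc[of "transpose Z" Z])
  then have "\<eta> \<bullet> (transpose Z *v (y - Z *v beta_hat Z y)) = 0"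
    by (simp add: matrix_vector_mult_diff_distrib del: transpose_matrix_vector)
  then show ?thesis by (simp only: inner_transpose_mult)
qed

text \<open>\<open>orth_proj\<close> is a definite description, so uniqueness of the projection has
  to be shown as well.\<close>

lemma orth_proj_complement:
  assumes "inj ((*v) Z)"
  shows "orth_proj ((col_space Z)\<^sup>\<bottom>) y = y - Z *v beta_hat Z y"
  unfolding orth_proj_def
proof (rule the_equality)
  let ?e = "y - Z *v beta_hat Z y"
  have e: "?e \<in> (col_space Z)\<^sup>\<bottom>"
    using beta_hat_residual_orthogonal[OF assms]
    by (auto simp: orthogonal_comp_def orthogonal_def col_space_eq_range)
  moreover have "orthogonal (y - ?e) z" if "z \<in> (col_space Z)\<^sup>\<bottom>" for z
    using that by (auto simp: orthogonal_comp_def col_space_eq_range)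
  ultimately show "?e \<in> (col_space Z)\<^sup>\<bottom> \<and> (\<forall>z\<in>(col_space Z)\<^sup>\<bottom>. orthogonal (y - ?e) z)" by blast
  fix p assume p: "p \<in> (col_space Z)\<^sup>\<bottom> \<and> (\<forall>z\<in>(col_space Z)\<^sup>\<bottom>. orthogonal (y - p) z)"
  \<comment> \<open>The difference of two candidates lies in the complement and is orthogonal to it,
    hence to itself.\<close>
  have "?e - p \<in> (col_space Z)\<^sup>\<bottom>"
    using p e by (simp add: orthogonal_comp_def orthogonal_def inner_diff_right)
  then have "(y - p) \<bullet> (?e - p) = 0" "(y - ?e) \<bullet> (?e - p) = 0"
    using p \<open>\<And>z. z \<in> (col_space Z)\<^sup>\<bottom> \<Longrightarrow> orthogonal (y - ?e) z\<close> by (auto simp: orthogonal_def)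
  then have "(?e - p) \<bullet> (?e - p) = 0"
    by (simp add: inner_diff_left)
  then show "p = ?e" by simp
qed

definition resid :: "real^'n^'n \<Rightarrow> real^'l^'n \<Rightarrow> real^'n \<Rightarrow> real^'n" where
  "resid D Z y = D *v y - (D ** Z) *v beta_hat (D ** Z) (D *v y)"

lemma linear_resid: "linear (resid D Z)"
  unfolding resid_def beta_hat_def matrix_vector_mul_assoc
  by (intro linear_compose_sub matrix_vector_mul_linear)

lemma resid_fitted: "inj ((*v) (D ** Z)) \<Longrightarrow> resid D Z (Z *v \<eta>) = 0"
  using beta_hat_fitted[of "D ** Z" \<eta>] by (simp add: resid_def matrix_vector_mul_assoc)

lemma resid_eq_0_iff:
  assumes "inj ((*v) D)" "inj ((*v) (D ** Z))"
  shows "resid D Z y = 0 \<longleftrightarrow> y \<in> col_space Z"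
proof
  assume "resid D Z y = 0"
  then have "D *v y = D *v (Z *v beta_hat (D ** Z) (D *v y))"
    by (simp add: resid_def matrix_vector_mul_assoc)
  then have "y = Z *v beta_hat (D ** Z) (D *v y)" using assms(1) by (simp add: inj_eq)
  then show "y \<in> col_space Z" by (metis col_space_eq_range rangeI)
qed (auto simp: col_space_eq_range resid_fitted[OF assms(2)])

text \<open>The fitted part of \<open>D *v y\<close> is orthogonal to the residual, which turns the
  bilinear expression in \<open>s2\<close> into a square. Positivity, scaling and continuity of
  \<open>s2\<close> are read off from this form.\<close>

lemma s2_eq:
  fixes D :: "real^'n^'n"
  assumes "inj ((*v) (D ** Z))"
  shows "s2 D Z y = (norm (resid D Z y))\<^sup>2 / real CARD('n)"
proof -
  have "y \<bullet> (transpose D *v resid D Z y) = (D *v y) \<bullet> resid D Z y"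
    by (rule inner_transpose_mult)
  also have "\<dots> = resid D Z y \<bullet> resid D Z y"
    using beta_hat_residual_orthogonal[OF assms, of _ "D *v y"]
    by (simp add: resid_def inner_diff_left)
  finally show ?thesis
    unfolding s2_def orth_proj_complement[OF assms] resid_def[symmetric]
    by (simp add: power2_norm_eq_inner)
qed

text \<open>The matrix is lower triangular with unit diagonal: the row belonging to the first
  nonzero entry of \<open>x\<close> returns just that entry.\<close>

lemma inj_A_mat: "inj ((*v) (A_mat :: real^('n::{finite,linorder})^('n::{finite,linorder})))"
proof (rule linear_injective_0[THEN iffD2], rule matrix_vector_mul_linear, intro allI impI)
  fix x :: "real^('n::{finite,linorder})" assume Ax: "A_mat *v x = 0"
  show "x = 0"
  proof (rule ccontr)
    assume "x \<noteq> 0"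
    then have ne: "{i. x $ i \<noteq> 0} \<noteq> {}" by (auto simp: vec_eq_iff)
    define i where "i = Min {i. x $ i \<noteq> 0}"
    have i: "x $ i \<noteq> 0" using Min_in[OF _ ne] by (simp add: i_def)
    have less: "x $ j = 0" if "j < i" for j
    proof (rule ccontr)
      assume "x $ j \<noteq> 0"
      then have "i \<le> j" unfolding i_def by (intro Min_le) auto
      with that show False by simp
    qed
    have "(A_mat *v x) $ i = (\<Sum>j\<in>UNIV. if j = i then x $ i else 0)"
      unfolding A_mat_def matrix_vector_mult_def vec_lambda_beta using less
      by (intro sum.cong) (auto simp: le_less)
    with Ax i show False by simp
  qed
qed

lemma inj_J_weight: "inj ((*v) (J_weight i :: real^('n::{finite,linorder})^('n::{finite,linorder})))"
proof (cases "i = 1")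
  case True
  then show ?thesis by (simp add: J_weight_def inj_on_def)
next
  case False
  then have "J_weight i = (A_mat :: real^('n::{finite,linorder})^('n::{finite,linorder}))" by (simp add: J_weight_def)
  then show ?thesis by (simp only: inj_A_mat)
qed

lemma inj_matrix_mult: "inj ((*v) D) \<Longrightarrow> inj ((*v) Z) \<Longrightarrow> inj ((*v) (D ** Z))"
  for D :: "real^'n^'p" and Z :: "real^'l^'n"
  unfolding inj_def matrix_vector_mul_assoc[symmetric] by blast

text \<open>Padding with zero auxiliary coefficients presents a fit by \<open>X\<close> as a fit by
  \<open>hcat X U\<close>.\<close>

definition embed_Inl :: "real^'k \<Rightarrow> real^('k::finite + 'm::finite)" where
  "embed_Inl \<eta> = (\<chi> j. case j of Inl a \<Rightarrow> \<eta> $ a | Inr _ \<Rightarrow> 0)"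

lemma sum_UNIV_Plus: "(\<Sum>j\<in>UNIV. f j) = (\<Sum>a\<in>UNIV. f (Inl a)) + (\<Sum>b\<in>UNIV. f (Inr b))"
  for f :: "'k::finite + 'm::finite \<Rightarrow> real"
  by (subst UNIV_Plus_UNIV[symmetric], subst sum.Plus) auto

lemma hcat_embed_Inl: "hcat X U *v embed_Inl \<eta> = X *v \<eta>"
  by (simp add: vec_eq_iff matrix_vector_mult_def hcat_def embed_Inl_def sum_UNIV_Plus)

lemma G_mat_mult: "(G_mat *v v) $ b = v $ Inr b"
  by (simp add: matrix_vector_mult_def G_mat_def sum_UNIV_Plus if_distrib[of "\<lambda>x. x * _"] cong: if_cong)

lemma G_mat_embed_Inl: "G_mat *v embed_Inl \<eta> = 0"
  by (simp add: vec_eq_iff G_mat_mult embed_Inl_def)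

lemma inj_transpose_G_mat: "inj ((*v) (transpose (G_mat :: real^('k::finite + 'm)^('m::finite))))"
proof (rule injI)
  fix x y :: "real^'m"
  assume *: "transpose (G_mat :: real^('k + 'm)^'m) *v x = transpose G_mat *v y"
  have "(transpose (G_mat :: real^('k + 'm)^'m) *v z) $ Inr b = z $ b" for z b
    by (simp add: matrix_vector_mult_def transpose_def G_mat_def if_distrib[of "\<lambda>x. x * _"] cong: if_cong)
  then show "x = y" by (metis * vec_eq_iff)
qed

text \<open>Turns coordinates of linear statistics into fixed directions, the form in which the
  Gaussian bounds apply.\<close>

lemma linear_component_vector:
  fixes h :: "real^'n \<Rightarrow> real^'p"
  assumes "linear h"
  shows "adjoint h (axis j 1) \<bullet> u = h u $ j"
  using adjoint_works[OF assms, of u "axis j 1"] by (simp add: inner_axis inner_commute[of _ u])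

lemma norm_le_components:
  fixes v :: "real^'p"
  assumes "\<And>j. \<bar>v $ j\<bar> \<le> s"
  shows "(norm v)\<^sup>2 \<le> real CARD('p) * s\<^sup>2"
proof -
  have "(norm v)\<^sup>2 = (\<Sum>j\<in>UNIV. (v $ j)\<^sup>2)"
    unfolding power2_norm_eq_inner inner_vec_def by (simp add: power2_eq_square)
  also have "\<dots> \<le> (\<Sum>j\<in>(UNIV::'p set). s\<^sup>2)"
    using assms by (intro sum_mono) (metis abs_ge_zero abs_le_square_iff abs_of_nonneg order_trans)
  finally show ?thesis by simp
qed

subsection \<open>The test statistic\<close>

text \<open>Rank conditions appear as injectivity, from which Gram matrices are positive definite.
  An arbitrary injective \<open>V\<close> treats \<open>A_mat\<close> and the identity at once, and
  \<open>card_less\<close> makes the span of \<open>X\<close> and \<open>U\<close> a proper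
  subspace.\<close>

locale Vogelsang_test =
  fixes X :: "real^'k^('n::{finite,linorder})" and U :: "real^'m^('n::{finite,linorder})"
    and R :: "real^'k^'q" and V :: "real^('n::{finite,linorder})^('n::{finite,linorder})" and c :: real and i :: nat
  assumes inj_XU: "inj ((*v) (hcat X U))"
    and inj_R: "inj ((*v) (transpose R))"
    and inj_V: "inj ((*v) V)"
    and card_less: "CARD('k) + CARD('m) < CARD('n)"
begin

abbreviation "D \<equiv> J_weight i :: real^('n::{finite,linorder})^('n::{finite,linorder})"
abbreviation "Z \<equiv> hcat X U"
abbreviation "N \<equiv> col_space Z"
abbreviation "aux_coef y \<equiv> (G_mat :: real^('k + 'm)^'m) *v beta_hat (D ** Z) (D *v y)"
abbreviation "K_mat \<equiv> (G_mat :: real^('k + 'm)^'m) ** matrix_inv (transpose Z ** transpose D ** D ** Z) ** transpose G_mat"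
abbreviation "W_mat \<equiv> R ** matrix_inv (transpose X ** transpose V ** V ** X) ** transpose R"
abbreviation "omega_scale (y :: real^('n::{finite,linorder})) \<equiv> real CARD('n) powi j_exp V * s2 A_mat X y * exp (c * J_stat i X U y)"

lemma inj_X: "inj ((*v) X)"
proof (rule injI)
  fix \<eta> \<zeta> assume "X *v \<eta> = X *v \<zeta>"
  then have "embed_Inl \<eta> = (embed_Inl \<zeta> :: real^('k + 'm))"
    using inj_XU by (metis hcat_embed_Inl injD)
  then have "embed_Inl \<eta> $ (Inl a :: 'k + 'm) = embed_Inl \<zeta> $ (Inl a :: 'k + 'm)" for a
    by simp
  then show "\<eta> = \<zeta>" by (simp add: embed_Inl_def vec_eq_iff)
qed

lemma inj_DZ: "inj ((*v) (D ** Z))"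
  and inj_VX: "inj ((*v) (V ** X))"
  and inj_AX: "inj ((*v) (A_mat ** X))"
  by (intro inj_matrix_mult inj_J_weight inj_XU inj_X inj_V inj_A_mat)+

lemma gram_DZ: "transpose Z ** transpose D ** D ** Z = transpose (D ** Z) ** (D ** Z)"
  and gram_VX: "transpose X ** transpose V ** V ** X = transpose (V ** X) ** (V ** X)"
  by (simp_all only: matrix_transpose_mul matrix_mul_assoc)

lemma pos_def_K: "pos_def K_mat"
  using pos_def_congruence[OF pos_def_inv[OF pos_def_gram[OF inj_DZ]] inj_transpose_G_mat]
  by (simp only: gram_DZ transpose_transpose)

lemma pos_def_W: "pos_def W_mat"
  using pos_def_congruence[OF pos_def_inv[OF pos_def_gram[OF inj_VX]] inj_R]
  by (simp only: gram_VX transpose_transpose)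

lemma subspace_N: "subspace N"
  by (simp add: col_space_def)

lemma fitted_in_N: "X *v \<eta> \<in> N"
  by (metis col_space_eq_range hcat_embed_Inl rangeI)

lemma col_space_X_subset: "col_space X \<subseteq> N"
  using fitted_in_N by (auto simp: col_space_eq_range[of X])

lemma dim_N: "dim N < CARD('n)"
proof -
  have "dim N \<le> CARD('k + 'm)"
    by (metis DIM_cart DIM_real card_UNIV_sum col_space_def dim_span mult.right_neutral column_rank_def rank_bound
        min.boundedE)
  then show ?thesis using card_less by simp
qed

lemma s2_D_pos: "y \<notin> N \<Longrightarrow> 0 < s2 D Z y"
  using resid_eq_0_iff[OF inj_J_weight inj_DZ, of y] by (simp add: s2_eq[OF inj_DZ])

text \<open>These residuals refer to \<open>X\<close> alone and vanish only on
  \<open>col_space X\<close>, which lies inside \<open>N\<close>.\<close>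

lemma s2_A_pos: "y \<notin> N \<Longrightarrow> 0 < s2 A_mat X y"
  using resid_eq_0_iff[OF inj_A_mat inj_AX, of y] col_space_X_subset by (auto simp: s2_eq[OF inj_AX])

lemma scale_pos: "y \<notin> N \<Longrightarrow> 0 < omega_scale y"
  using s2_A_pos[of y] by (intro mult_pos_pos) auto

lemma J_mid_eq: "J_mid D X U y = s2 D Z y *\<^sub>R K_mat"
  by (simp add: J_mid_def Let_def)

lemma J_stat_eq:
  assumes "y \<notin> N"
  shows "J_stat i X U y = (1 / real CARD('n)) * ((1 / s2 D Z y) * (aux_coef y \<bullet> (matrix_inv K_mat *v aux_coef y)))"
  using invertible_scaleR(2)[OF pos_def_invertible[OF pos_def_K], of "s2 D Z y"] s2_D_pos[OF assms]
  by (simp add: J_stat_def J_gen_def Let_def J_mid_eq scaleR_matrix_vector_assoc[symmetric])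

lemma estimators_defined: "beta_V_defined V X" "y \<notin> N \<Longrightarrow> Omega_Vo_defined U i V X y"
proof -
  show "beta_V_defined V X"
    unfolding beta_V_defined_def by (intro pos_def_invertible pos_def_gram inj_VX)
  assume "y \<notin> N"
  then show "Omega_Vo_defined U i V X y"
    unfolding Omega_Vo_defined_def Let_def J_mid_eq gram_VX
    using s2_D_pos[of y]
    by (intro conjI invertible_scaleR pos_def_invertible pos_def_gram inj_DZ inj_VX pos_def_K) auto
qed

lemma Omega_eq: "Omega_Vo c U i V X R y = omega_scale y *\<^sub>R W_mat"
  by (simp add: Omega_Vo_def)

lemma invertible_Omega: "y \<notin> N \<Longrightarrow> invertible (Omega_Vo c U i V X R y)"
  unfolding Omega_eq using scale_pos[of y]
  by (intro invertible_scaleR pos_def_invertible pos_def_W) auto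

section \<open>Equivariance and continuity of the estimators\<close>

lemma linear_beta_V: "linear (beta_V V X)"
  unfolding beta_V_def by (rule linear_beta_hat)

lemma beta_V_fitted: "beta_V V X (X *v \<eta>) = \<eta>"
  using beta_hat_fitted[OF inj_VX] by (simp add: beta_V_def matrix_vector_mul_assoc)

lemma beta_V_equivariant: "beta_V V X (\<delta> *\<^sub>R y + X *v \<eta>) = \<delta> *\<^sub>R beta_V V X y + \<eta>"
  by (simp add: linear_add[OF linear_beta_V] linear_cmul[OF linear_beta_V] beta_V_fitted)

lemma linear_aux_coef: "linear (\<lambda>y. aux_coef y)"
  using linear_compose[OF linear_beta_hat matrix_vector_mul_linear] by (simp add: comp_def)

lemma aux_coef_fitted: "aux_coef (X *v \<eta>) = 0"
proof -
  have "D *v (X *v \<eta>) = (D ** Z) *v embed_Inl \<eta>"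
    by (simp add: hcat_embed_Inl flip: matrix_vector_mul_assoc)
  then show ?thesis by (simp add: beta_hat_fitted[OF inj_DZ] G_mat_embed_Inl)
qed

lemma resid_equivariant:
  "resid D Z (\<delta> *\<^sub>R y + X *v \<eta>) = \<delta> *\<^sub>R resid D Z y"
  "resid A_mat X (\<delta> *\<^sub>R y + X *v \<eta>) = \<delta> *\<^sub>R resid A_mat X y"
proof -
  have "resid D Z (X *v \<eta>) = 0"
    using resid_fitted[OF inj_DZ] by (metis hcat_embed_Inl)
  then show "resid D Z (\<delta> *\<^sub>R y + X *v \<eta>) = \<delta> *\<^sub>R resid D Z y"
    by (simp add: linear_add[OF linear_resid] linear_cmul[OF linear_resid])
  show "resid A_mat X (\<delta> *\<^sub>R y + X *v \<eta>) = \<delta> *\<^sub>R resid A_mat X y"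
    by (simp add: linear_add[OF linear_resid] linear_cmul[OF linear_resid] resid_fitted[OF inj_AX])
qed

lemma s2_equivariant:
  "s2 D Z (\<delta> *\<^sub>R y + X *v \<eta>) = \<delta>\<^sup>2 * s2 D Z y"
  "s2 A_mat X (\<delta> *\<^sub>R y + X *v \<eta>) = \<delta>\<^sup>2 * s2 A_mat X y"
  by (simp_all add: s2_eq[OF inj_DZ] s2_eq[OF inj_AX] resid_equivariant power_mult_distrib)

lemma aux_coef_equivariant: "aux_coef (\<delta> *\<^sub>R y + X *v \<eta>) = \<delta> *\<^sub>R aux_coef y"
  using linear_add[OF linear_aux_coef, of "\<delta> *\<^sub>R y" "X *v \<eta>"] linear_cmul[OF linear_aux_coef, of \<delta> y]
  by (simp only: aux_coef_fitted add_0_right)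

lemma not_in_N_equivariant:
  assumes "y \<notin> N" "\<delta> \<noteq> 0"
  shows "\<delta> *\<^sub>R y + X *v \<eta> \<notin> N"
proof
  assume "\<delta> *\<^sub>R y + X *v \<eta> \<in> N"
  then have "(1 / \<delta>) *\<^sub>R ((\<delta> *\<^sub>R y + X *v \<eta>) - X *v \<eta>) \<in> N"
    using fitted_in_N by (intro subspace_scale subspace_diff subspace_N)
  with assms show False by simp
qed

text \<open>Auxiliary coefficients scale by \<open>\<delta>\<close> and \<open>s2\<close> by its
  square, and both ignore shifts along \<open>X\<close>, so the quotient has degree 0.\<close>

lemma J_stat_invariant:
  assumes "y \<notin> N" "\<delta> \<noteq> 0"
  shows "J_stat i X U (\<delta> *\<^sub>R y + X *v \<eta>) = J_stat i X U y"
  unfolding J_stat_eq[OF assms(1)] J_stat_eq[OF not_in_N_equivariant[OF assms]]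
    aux_coef_equivariant s2_equivariant
  using assms(2) by (simp add: matrix_vector_mult_scaleR power2_eq_square)

lemma Omega_equivariant:
  assumes "y \<notin> N" "\<delta> \<noteq> 0"
  shows "Omega_Vo c U i V X R (\<delta> *\<^sub>R y + X *v \<eta>) = \<delta>\<^sup>2 *\<^sub>R Omega_Vo c U i V X R y"
  unfolding Omega_eq J_stat_invariant[OF assms] s2_equivariant by (simp add: mult_ac)

text \<open>\<open>J_stat_eq\<close> replaces the inverse of a matrix depending on \<open>y\<close>
  by a fixed inverse and a division by \<open>s2 D Z y\<close>, which is positive off
  \<open>N\<close>.\<close>

lemma continuous_on_omega_scale: "continuous_on (- N) (\<lambda>y. omega_scale y)"
proof -
  note lin = linear_continuous_on[OF linear_conv_bounded_linear[THEN iffD1]]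
  have s2: "continuous_on S (s2 D Z)" "continuous_on S (s2 A_mat X)" for S
    unfolding s2_eq[OF inj_DZ, abs_def] s2_eq[OF inj_AX, abs_def]
    by (intro continuous_intros lin linear_resid; simp)+
  have "linear (\<lambda>y. matrix_inv K_mat *v aux_coef y)"
    using linear_compose[OF linear_aux_coef matrix_vector_mul_linear] by (simp add: comp_def)
  then have "continuous_on (- N) (\<lambda>y. (1 / real CARD('n)) * ((1 / s2 D Z y) * (aux_coef y \<bullet> (matrix_inv K_mat *v aux_coef y))))"
    using s2_D_pos by (intro continuous_intros s2 lin linear_aux_coef) (auto simp: less_le)
  then have "continuous_on (- N) (\<lambda>y. J_stat i X U y)"
    by (rule continuous_on_cong[THEN iffD1, rotated -1]) (auto simp: J_stat_eq)
  then show ?thesis by (intro continuous_intros s2)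
qed

lemma continuous_on_Omega: "continuous_on (- N) (Omega_Vo c U i V X R)"
  unfolding Omega_eq[abs_def] by (intro continuous_on_scaleR continuous_on_omega_scale continuous_on_const)

lemma estimator_conditions: "estimator_conditions X (beta_V V X) (Omega_Vo c U i V X R) N"
  unfolding estimator_conditions_def
proof (intro conjI allI impI)
  show "closed N" by (rule closed_subspace[OF subspace_N])
  \<comment> \<open>A subspace of smaller dimension is a null set.\<close>
  have "negligible N" using dim_N by (intro negligible_lowdim) simp
  then show "N \<in> null_sets lborel"
    using \<open>closed N\<close> by (simp add: negligible_iff_null_sets null_sets_completion_iff)
  show "continuous_on (- N) (beta_V V X)"
    by (intro linear_continuous_on linear_conv_bounded_linear[THEN iffD1] linear_beta_V)
  show "continuous_on (- N) (Omega_Vo c U i V X R)" by (rule continuous_on_Omega)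
  show "transpose (Omega_Vo c U i V X R y) = Omega_Vo c U i V X R y" for y
    unfolding Omega_eq using pos_def_W by (simp add: pos_def_def transpose_scalar)
  show "AE y in lborel. y \<notin> N \<longrightarrow> invertible (Omega_Vo c U i V X R y)"
    using invertible_Omega by auto
qed (use not_in_N_equivariant beta_V_equivariant Omega_equivariant in auto)

section \<open>Measurability and a deterministic lower bound for the statistic\<close>

abbreviation "T_stat r \<equiv> F_type_stat R r (beta_V V X) (Omega_Vo c U i V X R) N"

lemma N_star_eq: "N_star (Omega_Vo c U i V X R) N = N"
  using invertible_Omega by (auto simp: N_star_def invertible_det_nz)

lemma T_stat_eq:
  assumes "y \<notin> N"
  shows "T_stat r y = (1 / omega_scale y) * ((R *v beta_V V X y - r) \<bullet> (matrix_inv W_mat *v (R *v beta_V V X y - r)))"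
proof -
  have "matrix_inv (omega_scale y *\<^sub>R W_mat) = (1 / omega_scale y) *\<^sub>R matrix_inv W_mat"
    using scale_pos[OF assms] by (intro invertible_scaleR pos_def_invertible pos_def_W) auto
  then show ?thesis
    using assms by (simp only: F_type_stat_def N_star_eq Omega_eq if_False scaleR_matrix_vector_assoc[symmetric] inner_scaleR_right)
qed

text \<open>The rejection event is Borel because the statistic is continuous off the closed set
  \<open>N\<close> and constant on it.\<close>

lemma measurable_T_stat: "T_stat r \<in> borel_measurable borel"
proof -
  note lin = linear_continuous_on[OF linear_conv_bounded_linear[THEN iffD1]]
  have lin_inv: "linear (\<lambda>v. matrix_inv W_mat *v v)" by (rule matrix_vector_mul_linear)
  have num: "continuous_on S (\<lambda>y. R *v beta_V V X y - r)" for S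
    using linear_compose[OF linear_beta_V matrix_vector_mul_linear[of R]]
    by (intro continuous_intros lin) (simp add: comp_def)
  have "continuous_on S (\<lambda>y. matrix_inv W_mat *v (R *v beta_V V X y - r))" for S
    by (rule continuous_on_compose2[OF lin[OF lin_inv, of UNIV] num]) simp
  then have "continuous_on (- N) (\<lambda>y. (1 / omega_scale y) * ((R *v beta_V V X y - r) \<bullet> (matrix_inv W_mat *v (R *v beta_V V X y - r))))"
    using scale_pos
    by (intro continuous_on_mult continuous_on_divide continuous_on_inner continuous_on_const continuous_on_omega_scale num)
      (auto simp: less_le)
  moreover have "N \<in> sets borel" using closed_subspace[OF subspace_N] by simp
  ultimately have "(\<lambda>y. if y \<in> N then 0 else
      (1 / omega_scale y) * ((R *v beta_V V X y - r) \<bullet> (matrix_inv W_mat *v (R *v beta_V V X y - r)))) \<in> borel_measurable borel"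
    by (intro borel_measurable_continuous_on_if) auto
  moreover have "T_stat r = (\<lambda>y. if y \<in> N then 0 else
      (1 / omega_scale y) * ((R *v beta_V V X y - r) \<bullet> (matrix_inv W_mat *v (R *v beta_V V X y - r))))"
    using T_stat_eq by (auto simp: F_type_stat_def N_star_eq)
  ultimately show ?thesis by simp
qed

text \<open>The vector \<open>a\<close> carries the numerator of the statistic, \<open>S\<close> collects the residual
  and auxiliary coefficient directions that have to be small, and \<open>w\<close> keeps the observation
  away from \<open>N\<close>, so that the exponential factor stays bounded.\<close>

lemma T_stat_lower_bound:
  obtains a :: "real^('n::{finite,linorder})" and S :: "(real^('n::{finite,linorder})) set" and w :: "real^('n::{finite,linorder})" and \<kappa> K
  where "finite S" "\<And>x \<eta>. x \<in> S \<Longrightarrow> x \<bullet> (X *v \<eta>) = 0" "\<And>\<eta>. a \<bullet> (X *v \<eta>) = (R *v \<eta>) $ \<alpha>"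
    "w \<noteq> 0" "0 < \<kappa>" "0 \<le> K"
    "\<And>r \<mu> u p s d. \<mu> \<in> M0 X R r \<Longrightarrow> 0 \<le> p \<Longrightarrow> p \<le> \<bar>a \<bullet> u\<bar> \<Longrightarrow> 0 < s \<Longrightarrow>
      (\<And>x. x \<in> S \<Longrightarrow> \<bar>x \<bullet> u\<bar> \<le> s) \<Longrightarrow> 0 < d \<Longrightarrow> d \<le> \<bar>w \<bullet> u\<bar> \<Longrightarrow>
      \<kappa> * p\<^sup>2 / (s\<^sup>2 * exp (K * s\<^sup>2 / d\<^sup>2)) \<le> T_stat r (\<mu> + u)"
proof -
  have lin_R: "linear (\<lambda>u. R *v beta_V V X u)"
    using linear_compose[OF linear_beta_V matrix_vector_mul_linear] by (simp add: comp_def)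
  define a where "a = adjoint (\<lambda>u. R *v beta_V V X u) (axis \<alpha> 1)"
  have a: "a \<bullet> u = (R *v beta_V V X u) $ \<alpha>" for u
    unfolding a_def by (rule linear_component_vector[OF lin_R])
  \<comment> \<open>Coordinates of \<open>resid A_mat X\<close> control the scale
    \<open>s2 A_mat X\<close>, those of \<open>aux_coef\<close> the numerator of \<open>J\<close>;
    both kinds vanish on fitted vectors \<open>X *v \<eta>\<close>.\<close>
  define S where "S = range (\<lambda>j. adjoint (resid A_mat X) (axis j 1)) \<union> range (\<lambda>j. adjoint (\<lambda>y. aux_coef y) (axis j 1))"
  have S_resid: "\<exists>x\<in>S. \<forall>u. x \<bullet> u = resid A_mat X u $ j" for j
    unfolding S_def using linear_component_vector[OF linear_resid, of A_mat X] by blast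
  have S_aux: "\<exists>x\<in>S. \<forall>u. x \<bullet> u = aux_coef u $ j" for j
    unfolding S_def using linear_component_vector[OF linear_aux_coef] by blast
  \<comment> \<open>Since \<open>N\<close> is proper, some coordinate of \<open>resid D Z\<close> is
    not identically 0. It becomes \<open>w\<close>, and a lower bound on it keeps the denominator of
    \<open>J\<close> away from 0.\<close>
  have "\<exists>y. y \<notin> N"
  proof (rule ccontr)
    assume "\<nexists>y. y \<notin> N"
    then have "N = UNIV" by auto
    then show False using dim_N by (simp add: dim_UNIV)
  qed
  then obtain y0 where "y0 \<notin> N" by blast
  then have "resid D Z y0 \<noteq> 0" by (simp add: resid_eq_0_iff[OF inj_J_weight inj_DZ])
  then obtain j0 where j0: "resid D Z y0 $ j0 \<noteq> 0" by (auto simp: vec_eq_iff)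
  define w where "w = adjoint (resid D Z) (axis j0 1)"
  have w: "w \<bullet> u = resid D Z u $ j0" for u
    unfolding w_def by (rule linear_component_vector[OF linear_resid])
  obtain \<kappa>W where \<kappa>W: "0 < \<kappa>W" "\<And>x. \<kappa>W * (norm x)\<^sup>2 \<le> x \<bullet> (matrix_inv W_mat *v x)"
    using pos_def_ge[OF pos_def_inv[OF pos_def_W]] by metis
  obtain KK where KK: "0 \<le> KK" "\<And>x. x \<bullet> (matrix_inv K_mat *v x) \<le> KK * (norm x)\<^sup>2"
    using quadratic_form_le by metis
  define n where "n = real CARD('n)"
  define nj where "nj = n powi j_exp V"
  have n: "0 < n" "0 < nj" by (simp_all add: n_def nj_def)
  \<comment> \<open>\<open>\<bar>c\<bar>\<close> covers both signs of \<open>c\<close>, and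
    \<open>J\<close> is nonnegative. The sample sizes in \<open>J\<close> and in \<open>s2\<close>
    cancel.\<close>
  define K where "K = \<bar>c\<bar> * (KK * real CARD('m))"
  show thesis
  proof (rule that[of S a w "\<kappa>W / nj" K])
    show "finite S" by (simp add: S_def)
    show "x \<bullet> (X *v \<eta>) = 0" if "x \<in> S" for x \<eta>
      using that aux_coef_fitted[of \<eta>] resid_fitted[OF inj_AX, of \<eta>]
      by (auto simp: S_def linear_component_vector[OF linear_resid] linear_component_vector[OF linear_aux_coef])
    show "a \<bullet> (X *v \<eta>) = (R *v \<eta>) $ \<alpha>" for \<eta>
      by (simp add: a beta_V_fitted)
    show "w \<noteq> 0" using j0 w[of y0] by auto
    show "0 < \<kappa>W / nj" using \<kappa>W n by simp
    show "0 \<le> K" using KK(1) by (simp add: K_def)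
    fix r \<mu> u p s d
    assume "\<mu> \<in> M0 X R r" and p: "0 \<le> p" "p \<le> \<bar>a \<bullet> u\<bar>" and s: "0 < s" "\<And>x. x \<in> S \<Longrightarrow> \<bar>x \<bullet> u\<bar> \<le> s"
      and d: "0 < d" "d \<le> \<bar>w \<bullet> u\<bar>"
    then obtain \<beta> where \<mu>: "\<mu> = X *v \<beta>" "R *v \<beta> = r" by (auto simp: M0_def)
    have "resid D Z u \<noteq> 0" using d w[of u] by auto
    then have u: "u \<notin> N" by (simp add: resid_eq_0_iff[OF inj_J_weight inj_DZ])
    \<comment> \<open>Under the null hypothesis the mean is a fitted vector: equivariance removes it
      from the scale, and \<open>R *v \<beta> = r\<close> removes it from the numerator.\<close>
    have eq: "\<mu> + u = 1 *\<^sub>R u + X *v \<beta>" by (simp add: \<mu>)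
    have y: "\<mu> + u \<notin> N" unfolding eq by (rule not_in_N_equivariant[OF u]) simp
    have scale_eq: "omega_scale (\<mu> + u) = omega_scale u"
      unfolding eq J_stat_invariant[OF u one_neq_zero] s2_equivariant by simp
    have \<rho>: "R *v beta_V V X (\<mu> + u) - r = R *v beta_V V X u"
      unfolding eq beta_V_equivariant by (simp add: \<mu> matrix_vector_right_distrib)
    have s2A: "s2 A_mat X u \<le> s\<^sup>2"
    proof -
      have "\<bar>resid A_mat X u $ j\<bar> \<le> s" for j using S_resid[of j] s(2) by fastforce
      then have "(norm (resid A_mat X u))\<^sup>2 \<le> n * s\<^sup>2"
        unfolding n_def by (rule norm_le_components)
      then show ?thesis using n by (simp add: s2_eq[OF inj_AX] field_simps flip: n_def)
    qed
    have s2D: "d\<^sup>2 / n \<le> s2 D Z u"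
    proof -
      have "d \<le> norm (resid D Z u)"
        using d(2) component_le_norm_cart[of "resid D Z u" j0] by (simp add: w)
      then have "d\<^sup>2 \<le> (norm (resid D Z u))\<^sup>2" using d(1) by (intro power_mono) auto
      then show ?thesis using n by (simp add: s2_eq[OF inj_DZ] divide_right_mono flip: n_def)
    qed
    have J: "c * J_stat i X U u \<le> K * s\<^sup>2 / d\<^sup>2"
    proof -
      let ?q = "aux_coef u \<bullet> (matrix_inv K_mat *v aux_coef u)"
      have q0: "0 \<le> ?q"
        using pos_def_inv[OF pos_def_K] unfolding pos_def_def
        by (cases "aux_coef u = 0") (auto intro: less_imp_le)
      have "\<bar>aux_coef u $ j\<bar> \<le> s" for j using S_aux[of j] s(2) by fastforce
      then have "(norm (aux_coef u))\<^sup>2 \<le> real CARD('m) * s\<^sup>2"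
        by (rule norm_le_components)
      then have q: "?q \<le> KK * (real CARD('m) * s\<^sup>2)"
        using KK by (meson mult_left_mono order_trans)
      have "1 / s2 D Z u \<le> 1 / (d\<^sup>2 / n)"
        using s2D d(1) n s2_D_pos[OF u] by (intro divide_left_mono mult_pos_pos) auto
      then have "1 / s2 D Z u * ?q \<le> n / d\<^sup>2 * (KK * (real CARD('m) * s\<^sup>2))"
        using q q0 n by (intro mult_mono) auto
      then have "J_stat i X U u \<le> (1 / n) * (n / d\<^sup>2 * (KK * (real CARD('m) * s\<^sup>2)))"
        unfolding J_stat_eq[OF u] n_def[symmetric] using n by (intro mult_left_mono) auto
      also have "\<dots> = KK * real CARD('m) * s\<^sup>2 / d\<^sup>2" using n by simp
      finally have "J_stat i X U u \<le> KK * real CARD('m) * s\<^sup>2 / d\<^sup>2" .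
      moreover have "0 \<le> J_stat i X U u"
        unfolding J_stat_eq[OF u] using q0 s2_D_pos[OF u] by simp
      ultimately have "c * J_stat i X U u \<le> \<bar>c\<bar> * (KK * real CARD('m) * s\<^sup>2 / d\<^sup>2)"
        by (intro mult_mono) auto
      then show ?thesis by (simp add: K_def)
    qed
    have scale_le: "omega_scale u \<le> nj * s\<^sup>2 * exp (K * s\<^sup>2 / d\<^sup>2)"
      unfolding n_def[symmetric] nj_def[symmetric] using J s2A n s2_A_pos[OF u]
      by (intro mult_mono) auto
    let ?\<rho> = "R *v beta_V V X u"
    have "p \<le> norm ?\<rho>"
      using p(2) component_le_norm_cart[of ?\<rho> \<alpha>] by (simp add: a)
    then have "p\<^sup>2 \<le> (norm ?\<rho>)\<^sup>2" using p(1) by (intro power_mono) auto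
    then have "\<kappa>W * p\<^sup>2 \<le> ?\<rho> \<bullet> (matrix_inv W_mat *v ?\<rho>)"
      using \<kappa>W by (meson less_imp_le mult_left_mono order_trans)
    moreover have "1 / (nj * s\<^sup>2 * exp (K * s\<^sup>2 / d\<^sup>2)) \<le> 1 / omega_scale u"
      using scale_le scale_pos[OF u] by (intro divide_left_mono) (auto intro: mult_pos_pos less_le_trans)
    ultimately have "1 / (nj * s\<^sup>2 * exp (K * s\<^sup>2 / d\<^sup>2)) * (\<kappa>W * p\<^sup>2) \<le>
        1 / omega_scale u * (?\<rho> \<bullet> (matrix_inv W_mat *v ?\<rho>))"
      using \<kappa>W(1) scale_pos[OF u] by (intro mult_mono) (auto intro: less_imp_le)
    then show "\<kappa>W / nj * p\<^sup>2 / (s\<^sup>2 * exp (K * s\<^sup>2 / d\<^sup>2)) \<le> T_stat r (\<mu> + u)"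
      unfolding T_stat_eq[OF y] scale_eq \<rho> by (simp add: mult_ac)
  qed
qed

end

subsection \<open>Size one\<close>

text \<open>A union bound over three failures, each of probability at most \<open>e\<close>: a small
  projection on \<open>a\<close>, a small one on \<open>w\<close>, a large one on some
  \<open>x\<close> in \<open>S\<close>. Dependence between the projections does no harm.\<close>

lemma gaussian_directional_event:
  fixes B :: "real^'n^'n"
  assumes "transpose B = B" "\<And>x. 0 \<le> x \<bullet> (B *v x)" "0 < e" "finite S" "0 < t"
    and S: "\<And>x. x \<in> S \<Longrightarrow> x \<bullet> (B *v x) \<le> t"
    and "0 < a \<bullet> (B *v a)" "0 < w \<bullet> (B *v w)" "E \<in> sets borel"
    and E: "\<And>y. e * sqrt (a \<bullet> (B *v a)) \<le> \<bar>a \<bullet> (y - \<mu>)\<bar> \<Longrightarrow> e * sqrt (w \<bullet> (B *v w)) \<le> \<bar>w \<bullet> (y - \<mu>)\<bar> \<Longrightarrow>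
      (\<And>x. x \<in> S \<Longrightarrow> \<bar>x \<bullet> (y - \<mu>)\<bar> \<le> sqrt (real (card S + 1) * t / e)) \<Longrightarrow> y \<in> E"
  shows "1 - 3 * e \<le> measure (gaussian \<mu> B) E"
proof -
  interpret P: prob_space "gaussian \<mu> B" by (rule prob_space_gaussian)
  \<comment> \<open>At this level each tail probability is at most
    \<open>e / real (card S + 1)\<close>; the added 1 keeps \<open>s\<close> positive when
    \<open>S\<close> is empty.\<close>
  define s where "s = sqrt (real (card S + 1) * t / e)"
  have s: "0 < s" "s\<^sup>2 = real (card S + 1) * t / e"
    using assms by (simp_all add: s_def)
  let ?A = "\<lambda>v. {y. \<bar>v \<bullet> (y - \<mu>)\<bar> < e * sqrt (v \<bullet> (B *v v))}"
  let ?T = "\<lambda>x. {y. s \<le> \<bar>x \<bullet> (y - \<mu>)\<bar>}"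
  have meas: "?A v \<in> sets borel" "?T v \<in> sets borel" for v
    by measurable
  have small: "P.prob (?A v) \<le> e" if "0 < v \<bullet> (B *v v)" for v
    using gaussian_small_ball[OF assms(1,2) that, of "e * sqrt (v \<bullet> (B *v v))" \<mu>] that assms(3) by simp
  have tail: "P.prob (?T x) \<le> e / real (card S + 1)" if "x \<in> S" for x
  proof -
    have "P.prob (?T x) \<le> (x \<bullet> (B *v x)) / s\<^sup>2"
      by (rule gaussian_tail[OF assms(1,2) s(1)])
    also have "\<dots> \<le> t / s\<^sup>2" using S[OF that] by (intro divide_right_mono) auto
    also have "\<dots> = e / real (card S + 1)" using assms(3,5) by (simp add: s(2))
    finally show ?thesis .
  qed
  have "P.prob (\<Union>x\<in>S. ?T x) \<le> (\<Sum>x\<in>S. P.prob (?T x))"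
    using meas by (intro P.finite_measure_subadditive_finite assms(4)) auto
  also have "\<dots> \<le> (\<Sum>x\<in>S. e / real (card S + 1))" by (intro sum_mono tail)
  also have "\<dots> \<le> e" using assms(3) by (simp add: field_simps)
  finally have 1: "P.prob (\<Union>x\<in>S. ?T x) \<le> e" .
  have U: "(\<Union>x\<in>S. ?T x) \<in> sets borel" using meas assms(4) by (intro sets.finite_UN) auto
  have "- E \<subseteq> (?A a \<union> ?A w) \<union> (\<Union>x\<in>S. ?T x)"
    using E unfolding s_def[symmetric] by (force simp: not_le not_less)
  then have "P.prob (- E) \<le> P.prob ((?A a \<union> ?A w) \<union> (\<Union>x\<in>S. ?T x))"
    using meas U by (intro P.finite_measure_mono) auto
  also have "\<dots> \<le> P.prob (?A a \<union> ?A w) + P.prob (\<Union>x\<in>S. ?T x)"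
    using meas U by (intro measure_Un_le) auto
  also have "\<dots> \<le> (P.prob (?A a) + P.prob (?A w)) + P.prob (\<Union>x\<in>S. ?T x)"
    using meas by (intro add_right_mono measure_Un_le) auto
  also have "\<dots> \<le> 3 * e" using small[OF assms(7)] small[OF assms(8)] 1 by linarith
  finally show ?thesis using P.prob_compl[of E] assms(9) by (simp add: Compl_eq_Diff_UNIV)
qed

section \<open>Trend columns as moments, and the supremum of the rejection probabilities\<close>

lemma pos_surj:
  assumes "1 \<le> p" "p \<le> CARD('k)"
  obtains j :: "'k::{finite,linorder}" where "pos j = p"
proof -
  have "pos j \<in> {1..CARD('k)}" for j :: 'k
    unfolding pos_def by (auto simp: Suc_le_eq card_gt_0_iff intro: card_mono)
  moreover have "card (range (pos :: 'k \<Rightarrow> nat)) = CARD('k)"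
    by (rule card_image) (simp add: inj_on_def pos_inject)
  ultimately have "range (pos :: 'k \<Rightarrow> nat) = {1..CARD('k)}"
    by (intro card_subset_eq) auto
  then show thesis using assms that by (metis atLeastAtMost_iff imageE)
qed

text \<open>Positions count from 1 and degrees from 0, so the trend column at position
  \<open>pos j\<close> pairs to the moment of order \<open>pos j - 1\<close>.\<close>

lemma moment_eq_inner:
  assumes "polynomial_trend X R kF" "pos j \<le> kF"
  shows "moment x (pos j - 1) = x \<bullet> (X *v axis j 1)"
proof -
  have "(X *v axis j 1) $ i = X $ i $ j" for i
    by (simp add: matrix_vector_mul_component inner_axis)
  then show ?thesis
    using assms by (simp add: moment_def polynomial_trend_def inner_vec_def)
qed

theorem corollary5p8:
  fixes X :: "real^('k::{finite,linorder})^('n::{finite,linorder})"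
    and R :: "real^('k::{finite,linorder})^'q"
    and r :: "real^'q"
    and U :: "real^'m^('n::{finite,linorder})"
    and V :: "real^('n::{finite,linorder})^('n::{finite,linorder})"
    and c :: real
    and i kF :: nat
    and \<FF> :: "(real \<Rightarrow> real) set"
  assumes "CARD('k) < CARD('n)"
    and "rank X = CARD('k)"
    and "rank R = CARD('q)"
    and "\<FF> \<subseteq> F_all"
    and "F_AR2_ext \<subseteq> \<FF>"
    and "polynomial_trend X R kF"
    and "V \<in> {A_mat, mat 1}"
    and "i \<in> {1, 2}"
    and "CARD('k) + CARD('m) < CARD('n)"
    and "rank (hcat X U) = CARD('k) + CARD('m)"
  defines "N \<equiv> col_space (hcat X U)"
  defines "T \<equiv> F_type_stat R r (beta_V V X) (Omega_Vo c U i V X R) N"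
  shows "(\<forall>y. y \<notin> N \<longrightarrow> beta_V_defined V X \<and> Omega_Vo_defined U i V X y) \<and>
    estimator_conditions X (beta_V V X) (Omega_Vo c U i V X R) N \<and>
    (\<forall>C. \<forall>\<mu>0 \<in> M0 X R r. \<forall>\<sigma>2 > 0.
       (SUP f\<in>\<FF>. measure (gaussian \<mu>0 (\<sigma>2 *\<^sub>R Sigma_mat f)) {y. T y \<ge> C}) = 1)"
proof -
  interpret Vogelsang_test X U R V c i
  proof
    show "inj ((*v) (hcat X U))"
      using assms(10) by (simp add: full_rank_injective[symmetric])
    show "inj ((*v) (transpose R))"
      using assms(3) by (simp add: full_rank_injective[symmetric] rank_transpose)
    show "inj ((*v) V)"
      using assms(7) inj_A_mat by (auto simp: inj_on_def)
    show "CARD('k) + CARD('m) < CARD('n)" by (rule assms(9))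
  qed
  obtain l0 where l0: "pos l0 \<le> kF" "column l0 R \<noteq> 0"
    using assms(6) by (auto simp: polynomial_trend_def)
  have kF: "kF \<le> CARD('k)" using assms(6) by (simp add: polynomial_trend_def)
  \<comment> \<open>The degree of the trend that belongs to the first nonzero column of
    \<open>R\<close>; its position is \<open>Suc d\<close>.\<close>
  define d where "d = (LEAST d. \<exists>l. pos l = Suc d \<and> column l R \<noteq> 0)"
  have pos_pos: "0 < pos j" for j :: 'k by (auto simp: pos_def card_gt_0_iff)
  have "\<exists>l. pos l = Suc (pos l0 - 1) \<and> column l R \<noteq> 0"
    using l0 pos_pos[of l0] by auto
  then have "\<exists>l. pos l = Suc d \<and> column l R \<noteq> 0" and d_le: "d \<le> pos l0 - 1"
    unfolding d_def by (rule LeastI, rule Least_le)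
  then obtain l where l: "pos l = Suc d" "column l R \<noteq> 0" by blast
  have d_less: "d < kF" using d_le l0(1) pos_pos[of l0] by linarith
  obtain \<alpha> where \<alpha>: "R $ \<alpha> $ l \<noteq> 0" using l(2) by (auto simp: column_def vec_eq_iff)
  obtain a S w \<kappa> K where S: "finite S" "\<And>x \<eta>. x \<in> S \<Longrightarrow> x \<bullet> (X *v \<eta>) = 0"
    and a: "\<And>\<eta>. a \<bullet> (X *v \<eta>) = (R *v \<eta>) $ \<alpha>" and w: "w \<noteq> 0" and \<kappa>: "0 < \<kappa>" and K: "0 \<le> K"
    and T_ge: "\<And>r \<mu> u p s d. \<mu> \<in> M0 X R r \<Longrightarrow> 0 \<le> p \<Longrightarrow> p \<le> \<bar>a \<bullet> u\<bar> \<Longrightarrow> 0 < s \<Longrightarrow>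
      (\<And>x. x \<in> S \<Longrightarrow> \<bar>x \<bullet> u\<bar> \<le> s) \<Longrightarrow> 0 < d \<Longrightarrow> d \<le> \<bar>w \<bullet> u\<bar> \<Longrightarrow>
      \<kappa> * p\<^sup>2 / (s\<^sup>2 * exp (K * s\<^sup>2 / d\<^sup>2)) \<le> T_stat r (\<mu> + u)"
    using T_stat_lower_bound[of \<alpha>] by metis
  have moment: "\<exists>j :: 'k. pos j = Suc p \<and> (\<forall>x. moment x p = x \<bullet> (X *v axis j 1))" if p: "p < kF" for p
  proof -
    obtain j :: 'k where j: "pos j = Suc p" by (rule pos_surj[of "Suc p"]) (use p kF in auto)
    then show ?thesis using moment_eq_inner[OF assms(6), of j] p by auto
  qed
  have moment_S: "moment x p = 0" if "x \<in> S" "p < kF" for x p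
    using moment[OF that(2)] S(2)[OF that(1)] by auto
  have R_axis: "(R *v axis j 1) $ \<alpha> = R $ \<alpha> $ j" for j by (simp add: matrix_vector_mul_component inner_axis)
  \<comment> \<open>Moments of \<open>a\<close> are the entries of row \<open>\<alpha>\<close> of
    \<open>R\<close>, and all columns before \<open>l\<close> are zero; at degree \<open>d\<close>
    the entry \<open>R $ \<alpha> $ l\<close> is nonzero.\<close>
  have moment_a: "moment a p = 0" if p: "p < d" for p
  proof -
    obtain j :: 'k where j: "pos j = Suc p" "\<And>x. moment x p = x \<bullet> (X *v axis j 1)"
      using moment[OF less_trans[OF p d_less]] by blast
    have "column j R = 0"
      using not_less_Least[OF p[unfolded d_def]] j(1) by blast
    then have "R $ \<alpha> $ j = 0" by (simp add: column_def vec_eq_iff)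
    then show ?thesis using j(2)[of a] by (simp add: a R_axis del: matrix_vector_mult_basis)
  qed
  have "moment a d \<noteq> 0"
  proof -
    obtain j :: 'k where j: "pos j = Suc d" "\<And>x. moment x d = x \<bullet> (X *v axis j 1)"
      using moment[OF d_less] by blast
    have "j = l" using j(1) l(1) by (simp flip: pos_inject)
    then show ?thesis using j(2)[of a] \<alpha> by (simp add: a R_axis del: matrix_vector_mult_basis)
  qed
  obtain \<kappa>' where \<kappa>': "0 < \<kappa>'" and sep: "\<And>H. \<exists>f\<in>F_AR2_ext. \<exists>t>0. (\<forall>x\<in>S. x \<bullet> (Sigma_mat f *v x) \<le> t) \<and>
    \<kappa>' * t \<le> w \<bullet> (Sigma_mat f *v w) \<and> H * t \<le> a \<bullet> (Sigma_mat f *v a)"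
    using spectral_separation[OF S(1) moment_S w moment_a \<open>moment a d \<noteq> 0\<close> d_less] by metis
  have size: "(SUP f\<in>\<FF>. measure (gaussian \<mu> (\<sigma>2 *\<^sub>R Sigma_mat f)) {y. T y \<ge> C}) = 1"
    if \<mu>: "\<mu> \<in> M0 X R r" and \<sigma>: "0 < \<sigma>2" for \<mu> \<sigma>2 C
  proof -
    let ?P = "\<lambda>f. measure (gaussian \<mu> (\<sigma>2 *\<^sub>R Sigma_mat f)) {y. T y \<ge> C}"
    have T: "T = T_stat r" by (simp add: T_def N_def)
    have event: "{y. T y \<ge> C} \<in> sets borel"
      using measurable_T_stat[of r] unfolding T by measurable
    have P_le: "?P f \<le> 1" for f
      using prob_space.prob_le_1[OF prob_space_gaussian] .
    have bdd: "bdd_above (?P ` \<FF>)" using P_le by (auto intro!: bdd_aboveI)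
    have approx: "\<exists>f\<in>\<FF>. 1 - 3 * e \<le> ?P f" if e: "0 < e" for e
    proof -
      define q where "q = real (card S + 1)"
      \<comment> \<open>With squared tail level \<open>q * t' / e\<close> and squared lower level
        along \<open>w\<close> at least \<open>e\<^sup>2 * \<kappa>' * t'\<close>, the scale
        \<open>t'\<close> cancels and \<open>M\<close> bounds the exponent. \<open>H\<close> is then
        solved for so that the lower bound of the statistic is at least
        \<open>\<bar>C\<bar> + 1\<close>; it may use \<open>\<kappa>'\<close>, which was fixed
        earlier.\<close>
      define M where "M = K * q / (e ^ 3 * \<kappa>')"
      define H where "H = (\<bar>C\<bar> + 1) * q * exp M / (\<kappa> * e ^ 3)"
      have q: "0 < q" by (simp add: q_def)
      have H: "0 < H" using q \<kappa> e by (simp add: H_def)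
      obtain f t where f: "f \<in> F_AR2_ext" and t: "0 < t" "\<And>x. x \<in> S \<Longrightarrow> x \<bullet> (Sigma_mat f *v x) \<le> t"
        "\<kappa>' * t \<le> w \<bullet> (Sigma_mat f *v w)" "H * t \<le> a \<bullet> (Sigma_mat f *v a)"
        using sep[of H] by blast
      have f_int: "integrable (lebesgue_on {-pi..pi}) f" and f_nonneg: "\<And>\<theta>. \<theta> \<in> {-pi..pi} \<Longrightarrow> 0 \<le> f \<theta>"
        using f assms(4,5) by (auto simp: F_all_def)
      define B where "B = \<sigma>2 *\<^sub>R (Sigma_mat f :: real^('n::{finite,linorder})^('n::{finite,linorder}))"
      have quad: "x \<bullet> (B *v x) = \<sigma>2 * (x \<bullet> (Sigma_mat f *v x))" for x
        by (simp add: B_def scaleR_matrix_vector_assoc[symmetric])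
      have sym: "transpose B = B"
        unfolding B_def transpose_scalar by (simp only: transpose_Sigma_mat[OF f_int])
      have psd: "0 \<le> x \<bullet> (B *v x)" for x
        unfolding quad Sigma_mat_quadratic_form[OF f_int] using \<sigma> f_nonneg
        by (intro mult_nonneg_nonneg Bochner_Integration.integral_nonneg_AE AE_I2) auto
      \<comment> \<open>The variance factor rescales all three bounds alike and drops out of the
        ratios.\<close>
      define t' where "t' = \<sigma>2 * t"
      have t': "0 < t'" "\<And>x. x \<in> S \<Longrightarrow> x \<bullet> (B *v x) \<le> t'" "\<kappa>' * t' \<le> w \<bullet> (B *v w)" "H * t' \<le> a \<bullet> (B *v a)"
        using t \<sigma> by (auto simp: t'_def quad mult.left_commute)
      have va: "0 < a \<bullet> (B *v a)" and vw: "0 < w \<bullet> (B *v w)"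
        using t' H \<kappa>' by (auto intro: less_le_trans[OF mult_pos_pos])
      define s where "s = sqrt (q * t' / e)"
      have s: "0 < s" "s\<^sup>2 = q * t' / e" using q t'(1) e by (simp_all add: s_def)
      have "1 - 3 * e \<le> measure (gaussian \<mu> B) {y. T y \<ge> C}"
      proof (rule gaussian_directional_event[OF sym psd e S(1) t'(1,2) va vw event])
        fix y
        assume y: "e * sqrt (a \<bullet> (B *v a)) \<le> \<bar>a \<bullet> (y - \<mu>)\<bar>" "e * sqrt (w \<bullet> (B *v w)) \<le> \<bar>w \<bullet> (y - \<mu>)\<bar>"
          "\<And>x. x \<in> S \<Longrightarrow> \<bar>x \<bullet> (y - \<mu>)\<bar> \<le> sqrt (real (card S + 1) * t' / e)"
        let ?p = "e * sqrt (a \<bullet> (B *v a))" and ?d = "e * sqrt (w \<bullet> (B *v w))"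
        have p2: "?p\<^sup>2 = e\<^sup>2 * (a \<bullet> (B *v a))" and d2: "?d\<^sup>2 = e\<^sup>2 * (w \<bullet> (B *v w))"
          using va vw by (simp_all add: power_mult_distrib)
        have "\<kappa> * ?p\<^sup>2 / (s\<^sup>2 * exp (K * s\<^sup>2 / ?d\<^sup>2)) \<le> T_stat r (\<mu> + (y - \<mu>))"
          using y e va vw s(1) by (intro T_ge[OF \<mu>]) (auto simp: s_def q_def)
        then have "\<kappa> * ?p\<^sup>2 / (s\<^sup>2 * exp (K * s\<^sup>2 / ?d\<^sup>2)) \<le> T y" by (simp add: T)
        moreover have "C \<le> \<kappa> * ?p\<^sup>2 / (s\<^sup>2 * exp (K * s\<^sup>2 / ?d\<^sup>2))"
        proof -
          have "K * s\<^sup>2 / ?d\<^sup>2 \<le> K * s\<^sup>2 / (e\<^sup>2 * (\<kappa>' * t'))"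
            unfolding d2 using K e t' \<kappa>' vw by (intro divide_left_mono mult_left_mono mult_pos_pos mult_nonneg_nonneg) auto
          also have "\<dots> = M"
            unfolding s(2) M_def using e t'(1) \<kappa>' by (simp add: field_simps power2_eq_square power3_eq_cube)
          finally have M: "exp (K * s\<^sup>2 / ?d\<^sup>2) \<le> exp M" by simp
          have "C \<le> \<bar>C\<bar> + 1" by simp
          also have "\<dots> = \<kappa> * (e\<^sup>2 * (H * t')) / (s\<^sup>2 * exp M)"
            unfolding s(2) H_def using e t'(1) q \<kappa> by (simp add: field_simps power2_eq_square power3_eq_cube)
          also have "\<dots> \<le> \<kappa> * (e\<^sup>2 * (a \<bullet> (B *v a))) / (s\<^sup>2 * exp (K * s\<^sup>2 / ?d\<^sup>2))"
            using M s(1) \<kappa> e t'(4) va by (intro frac_le mult_left_mono mult_pos_pos mult_nonneg_nonneg) auto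
          finally show ?thesis unfolding p2 .
        qed
        ultimately show "y \<in> {y. T y \<ge> C}" by simp
      qed
      then show ?thesis using f assms(5) by (auto simp: B_def)
    qed
    \<comment> \<open>Suprema of reals are meaningful only for nonempty bounded families.\<close>
    have "\<FF> \<noteq> {}" using approx[of 1] by auto
    then have "(SUP f\<in>\<FF>. ?P f) \<le> 1" using P_le by (intro cSUP_least) auto
    moreover have "1 \<le> (SUP f\<in>\<FF>. ?P f)"
    proof (rule field_le_epsilon)
      fix e :: real assume "0 < e"
      then obtain f where "f \<in> \<FF>" "1 - 3 * (e / 3) \<le> ?P f" using approx[of "e / 3"] by auto
      moreover have "?P f \<le> (SUP f\<in>\<FF>. ?P f)" using bdd \<open>f \<in> \<FF>\<close> by (intro cSUP_upper)
      ultimately show "1 \<le> (SUP f\<in>\<FF>. ?P f) + e" by simp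
    qed
    ultimately show ?thesis by (rule antisym)
  qed
  show ?thesis
    using estimators_defined estimator_conditions size unfolding N_def by blast
qed

end
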